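(* Let $P$ be a finite poset, and equip $\mathcal{F}^{(e)}(P)$ with the partial ordering $\ge$ defined in the context. For a chain $K$ in $\mathcal{F}^{(e)}(P)$, define $S^{(e)}_K=\operatorname{conv}K$ and $T^{(e)}_K=\operatorname{conv}\Phi^{(e)}(K)$. Then: (a) The set $\mathcal{S}^{(e)}_P=\{S^{(e)}_K : K \text{ is a chain in } \mathcal{F}^{(e)}(P)\}$ is a unimodular triangulation of the enriched order polytope $\mathcal{O}^{(e)}(P)$. (b) The set $\mathcal{T}^{(e)}_P=\{T^{(e)}_K : K \text{ is a chain in } \mathcal{F}^{(e)}(P)\}$ is a unimodular triangulation of the enriched chain polytope $\mathcal{C}^{(e)}(P)$.
   Context: $\mathbb{R}^P$ (resp. $\mathbb{Z}^P$) is the set of real-valued (resp. integer-valued) functions on $P$; with $d=\#P$, $\mathbb{R}^P$ is identified with $\mathbb{R}^d$. For $f\in\mathbb{R}^P$, $\operatorname{supp}(f)=\{v\in P: f(v)\neq 0\}$. An order filter of $P$ is a subset $F\subset P$ such that $v\in F$ and $v<w$ imply $w\in F$. $\mathcal{F}^{(e)}(P)$ is the set of $f\in\mathbb{Z}^P$ such that (i) $f(v)\in\{1,0,-1\}$ for any $v\in P$, (ii) $\operatorname{supp}(f)$ is an order filter of $P$, and (iii) if $f(v)=-1$, then $v$ is minimal in $\operatorname{supp}(f)$. $\mathcal{A}^{(e)}(P)$ is the set of $f\in\mathbb{Z}^P$ with values in $\{1,0,-1\}$ whose support is an antichain of $P$. $\mathcal{O}^{(e)}(P)=\operatorname{conv}\mathcal{F}^{(e)}(P)$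 and $\mathcal{C}^{(e)}(P)=\operatorname{conv}\mathcal{A}^{(e)}(P)$. Partial ordering on $\mathcal{F}^{(e)}(P)$: for $f,g\in\mathcal{F}^{(e)}(P)$, $f>g$ if (i) $\operatorname{supp}(f)\supsetneq\operatorname{supp}(g)$; (ii) $f(v)\ge g(v)$ for any $v\in\operatorname{supp}(g)$; (iii) if $v\in\operatorname{supp}(g)$ and $v$ is minimal in $\operatorname{supp}(f)$, then $f(v)=g(v)$. And $f\ge g$ means $f=g$ or $f>g$. Chains in $\mathcal{F}^{(e)}(P)$ include the empty chain ($\operatorname{conv}\emptyset=\emptyset$). The enriched transfer map $\Phi^{(e)}:\mathbb{R}^P\to\mathbb{R}^P$ is defined inductively by $(\Phi^{(e)}f)(v)=f(v)$ if $v$ is minimal in $P$, and $(\Phi^{(e)}f)(v)=f(v)-\max\{\sum_{i=1}^r|(\Phi^{(e)}f)(v_i)| : v>v_1>\dots>v_r \text{ a chain in } P\}$ otherwise. A (lattice) triangulation of a $d$-dimensional lattice polytope $\mathcal{P}\subset\mathbb{R}^d$ is a finite collection $\Delta$ of (lattice) simplices such that (i) every face of a member of $\Delta$ is in $\Delta$, (ii) the union of the simplices in $\Delta$ is $\mathcal{P}$, and (iii) any two elements of $\Delta$ intersect in a common (possibly empty) face. It is unimodular if all maximal faces of $\Delta$ have Euclidean volume $1/d!$. *)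

theory Defs
  imports "HOL-Analysis.Analysis"
begin

section \<open>Enriched order and chain polytopes\<close>

text \<open>
  The poset \<open>P\<close> is a type of sort \<open>{finite, order}\<close>. The space of real functions on \<open>P\<close> is
  \<^typ>\<open>real ^ 'p\<close>, so that convex hulls and Lebesgue measure are those of \<open>d\<close>-dimensional
  Euclidean space with \<open>d = CARD('p)\<close>.
\<close>

definition minimal_in :: "'p::order set \<Rightarrow> 'p \<Rightarrow> bool" where
  "minimal_in A v \<longleftrightarrow> v \<in> A \<and> (\<forall>w\<in>A. \<not> w < v)"

definition order_filter :: "'p::order set \<Rightarrow> bool" where
  "order_filter F \<longleftrightarrow> (\<forall>v w. v \<in> F \<and> v < w \<longrightarrow> w \<in> F)"

definition antichain :: "'p::order set \<Rightarrow> bool" where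
  "antichain A \<longleftrightarrow> (\<forall>v\<in>A. \<forall>w\<in>A. \<not> v < w)"

definition supp :: "real ^ 'p \<Rightarrow> 'p set" where
  "supp f = {v. f $ v \<noteq> 0}"

definition integer_points :: "(real ^ 'p) set" where
  "integer_points = {f. \<forall>v. f $ v \<in> \<int>}"

definition enriched_filters :: "(real ^ 'p::{finite,order}) set" where
  "enriched_filters =
     {f \<in> integer_points.
        (\<forall>v. f $ v \<in> {1, 0, -1}) \<and>
        order_filter (supp f) \<and>
        (\<forall>v. f $ v = -1 \<longrightarrow> minimal_in (supp f) v)}"

definition enriched_antichains :: "(real ^ 'p::{finite,order}) set" where
  "enriched_antichains =
     {f \<in> integer_points. (\<forall>v. f $ v \<in> {1, 0, -1}) \<and> antichain (supp f)}"

definition enriched_order_polytope :: "(real ^ 'p::{finite,order}) set" where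
  "enriched_order_polytope = convex hull enriched_filters"

definition enriched_chain_polytope :: "(real ^ 'p::{finite,order}) set" where
  "enriched_chain_polytope = convex hull enriched_antichains"

definition enriched_greater :: "real ^ 'p::{finite,order} \<Rightarrow> real ^ 'p::{finite,order} \<Rightarrow> bool" where
  "enriched_greater f g \<longleftrightarrow>
     supp g \<subset> supp f \<and>
     (\<forall>v\<in>supp g. f $ v \<ge> g $ v) \<and>
     (\<forall>v. v \<in> supp g \<and> minimal_in (supp f) v \<longrightarrow> f $ v = g $ v)"

definition enriched_ge :: "real ^ 'p::{finite,order} \<Rightarrow> real ^ 'p::{finite,order} \<Rightarrow> bool" where
  "enriched_ge f g \<longleftrightarrow> f = g \<or> enriched_greater f g"

definition enriched_filter_chains :: "(real ^ 'p::{finite,order}) set set" where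
  "enriched_filter_chains =
     {K. K \<subseteq> enriched_filters \<and> Complete_Partial_Order.chain enriched_ge K}"

text \<open>
  A chain \<open>v > v\<^sub>1 > \<dots> > v\<^sub>r\<close> (with \<open>r \<ge> 1\<close>) is encoded by its nonempty, totally ordered set
  \<open>{v\<^sub>1, \<dots>, v\<^sub>r}\<close> of elements below \<open>v\<close>.
\<close>

function transfer_coord :: "real ^ 'p::{finite,order} \<Rightarrow> 'p \<Rightarrow> real" where
  "transfer_coord f v =
     (if minimal_in UNIV v then f $ v
      else f $ v -
        Max ((\<lambda>C. \<Sum>w\<in>C. \<bar>transfer_coord f w\<bar>) `
             {C. C \<noteq> {} \<and> C \<subseteq> {..<v} \<and> Complete_Partial_Order.chain (\<le>) C}))"
  by pat_completeness auto
termination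
  by (relation "inv_image less_than (\<lambda>(f, v). card {..<v})")
     (auto intro!: psubset_card_mono dest: less_trans)

declare transfer_coord.simps [simp del]

definition enriched_transfer :: "real ^ 'p::{finite,order} \<Rightarrow> real ^ 'p::{finite,order}" where
  "enriched_transfer f = (\<chi> v. transfer_coord f v)"

section \<open>Unimodular triangulations\<close>

definition lattice_polytope :: "(real ^ 'n) set \<Rightarrow> bool" where
  "lattice_polytope X \<longleftrightarrow> (\<exists>V. finite V \<and> V \<subseteq> integer_points \<and> X = convex hull V)"

text \<open>
  The library's \<^const>\<open>simplicial_complex\<close> is finiteness, every member being a simplex (the empty
  set counts as the simplex of dimension \<open>-1\<close>), closure under faces (including the empty face),
  and any two members meeting in a common face.

  Triangulations are only defined for full-dimensional lattice polytopes, so this requirement on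
  \<open>X\<close> is part of the predicate.
\<close>

definition lattice_triangulation :: "(real ^ 'n) set set \<Rightarrow> (real ^ 'n) set \<Rightarrow> bool" where
  "lattice_triangulation \<Delta> X \<longleftrightarrow>
     lattice_polytope X \<and> aff_dim X = int CARD('n) \<and>
     simplicial_complex \<Delta> \<and> (\<forall>S\<in>\<Delta>. lattice_polytope S) \<and> \<Union>\<Delta> = X"

definition unimodular_triangulation :: "(real ^ 'n) set set \<Rightarrow> (real ^ 'n) set \<Rightarrow> bool" where
  "unimodular_triangulation \<Delta> X \<longleftrightarrow>
     lattice_triangulation \<Delta> X \<and>
     (\<forall>S\<in>\<Delta>. (\<forall>T\<in>\<Delta>. \<not> S \<subset> T) \<longrightarrow> measure lebesgue S = 1 / fact CARD('n))"

section \<open>The two families of simplices\<close>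

definition order_simplex :: "(real ^ 'p::{finite,order}) set \<Rightarrow> (real ^ 'p::{finite,order}) set" where
  "order_simplex K = convex hull K"

definition chain_simplex :: "(real ^ 'p::{finite,order}) set \<Rightarrow> (real ^ 'p::{finite,order}) set" where
  "chain_simplex K = convex hull (enriched_transfer ` K)"

definition order_simplices :: "(real ^ 'p::{finite,order}) set set" where
  "order_simplices = {order_simplex K | K. K \<in> enriched_filter_chains}"

definition chain_simplices :: "(real ^ 'p::{finite,order}) set set" where
  "chain_simplices = {chain_simplex K | K. K \<in> enriched_filter_chains}"

end

theory Submission
  imports Defs
begin

text \<open>
  Write \<open>y = \<Phi> x\<close>. The transfer map is inverted by adding to \<open>y\<close> at \<open>v\<close> the largest sum of \<open>\<bar>y\<bar>\<close> over
  a chain below \<open>v\<close>; let \<open>height y v\<close> be that largest sum plus \<open>\<bar>y v\<bar>\<close>. The level sets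
  \<open>{v. t \<le> height y v}\<close>, \<open>t > 0\<close>, are filters; giving their minimal elements the signs of \<open>y\<close> turns
  them into a chain \<open>D y\<close> of enriched filters. If \<open>y\<close> is a convex combination of \<open>\<Phi> ` K\<close> for a chain
  \<open>K\<close>, then \<open>x\<close> is the same combination of \<open>K\<close>, and the members of \<open>K\<close> with positive coefficient all
  lie in \<open>D y\<close>: two simplices of either family through the same point therefore meet in a common face
  there. Conversely, if all heights are at most 1, then the gaps between consecutive heights are the
  coefficients of such a combination of \<open>D y\<close>; an induction on \<open>v\<close> gives this bound on both
  polytopes. A maximal chain adds one element to the support at a time, so the matrix of its vertices
  is triangular with diagonal entries \<open>\<plusminus>1\<close>, for \<open>K\<close> and for \<open>\<Phi> ` K\<close> alike.
\<close>

section \<open>Heights and the inverse of the transfer map\<close>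

definition chain_max :: "real ^ 'p::{finite,order} \<Rightarrow> 'p \<Rightarrow> real" where
  "chain_max y v =
     Max ((\<lambda>C. \<Sum>w\<in>C. \<bar>y $ w\<bar>) ` {C. C \<subseteq> {..<v} \<and> Complete_Partial_Order.chain (\<le>) C})"

definition height :: "real ^ 'p::{finite,order} \<Rightarrow> 'p \<Rightarrow> real" where
  "height y v = \<bar>y $ v\<bar> + chain_max y v"

lemma chain_sum_le_chain_max:
  assumes "C \<subseteq> {..<v}" "Complete_Partial_Order.chain (\<le>) C"
  shows "(\<Sum>w\<in>C. \<bar>y $ w\<bar>) \<le> chain_max y v"
  unfolding chain_max_def using assms by (intro Max_ge) auto

lemma chain_max_attained:
  obtains C where "C \<subseteq> {..<v}" "Complete_Partial_Order.chain (\<le>) C"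
    "chain_max y v = (\<Sum>w\<in>C. \<bar>y $ w\<bar>)"
proof -
  have "{} \<in> {C. C \<subseteq> {..<v} \<and> Complete_Partial_Order.chain (\<le>) C}"
    by (simp add: Complete_Partial_Order.chain_def)
  then have "chain_max y v \<in> (\<lambda>C. \<Sum>w\<in>C. \<bar>y $ w\<bar>) `
      {C. C \<subseteq> {..<v} \<and> Complete_Partial_Order.chain (\<le>) C}"
    unfolding chain_max_def by (intro Max_in) auto
  then show ?thesis
    using that by auto
qed

lemma chain_max_nonneg: "0 \<le> chain_max y v"
  using chain_sum_le_chain_max[of "{}" v y] by (simp add: Complete_Partial_Order.chain_def)

lemma height_nonneg: "0 \<le> height y v"
  by (simp add: height_def chain_max_nonneg)

lemma chain_max_le_height: "chain_max y v \<le> height y v"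
  by (simp add: height_def)

text \<open>Putting \<open>w\<close> on top of an optimal chain below \<open>w\<close> gives a chain
  below \<open>v\<close>.\<close>

lemma height_le_chain_max:
  fixes v w :: "'p::{finite,order}"
  assumes "w < v"
  shows "height y w \<le> chain_max y v"
proof -
  obtain C where C: "C \<subseteq> {..<w}" "Complete_Partial_Order.chain (\<le>) C"
      "chain_max y w = (\<Sum>u\<in>C. \<bar>y $ u\<bar>)"
    by (rule chain_max_attained)
  have "insert w C \<subseteq> {..<v}"
    using C(1) assms by (auto dest: less_trans)
  moreover have "Complete_Partial_Order.chain (\<le>) (insert w C)"
    using C(1,2) unfolding Complete_Partial_Order.chain_def by (auto intro: less_imp_le)
  ultimately have "(\<Sum>u\<in>insert w C. \<bar>y $ u\<bar>) \<le> chain_max y v"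
    by (rule chain_sum_le_chain_max)
  moreover have "w \<notin> C"
    using C(1) by auto
  ultimately show ?thesis
    by (simp add: height_def C(3))
qed

text \<open>A nonempty optimal chain is its top element \<open>w\<close> together with a chain below
  \<open>w\<close>, so its sum is at most \<open>height y w\<close>. With
  \<open>height_le_chain_max\<close> this makes \<open>chain_max y v\<close> the maximum of 0 and
  the heights below \<open>v\<close>; later inductions use this in place of chains.\<close>

lemma chain_max_le_iff: "chain_max y v \<le> c \<longleftrightarrow> 0 \<le> c \<and> (\<forall>w<v. height y w \<le> c)"
proof
  assume "chain_max y v \<le> c"
  then show "0 \<le> c \<and> (\<forall>w<v. height y w \<le> c)"
    using chain_max_nonneg[of y v] height_le_chain_max[of _ v y] by force
next
  assume c: "0 \<le> c \<and> (\<forall>w<v. height y w \<le> c)"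
  obtain C where C: "C \<subseteq> {..<v}" "Complete_Partial_Order.chain (\<le>) C"
      "chain_max y v = (\<Sum>u\<in>C. \<bar>y $ u\<bar>)"
    by (rule chain_max_attained)
  show "chain_max y v \<le> c"
  proof (cases "C = {}")
    case False
    obtain w where w: "w \<in> C" "\<And>u. u \<in> C \<Longrightarrow> \<not> w < u"
      using finite_has_maximal[of C] False by (auto simp: less_le)
    have "C - {w} \<subseteq> {..<w}"
      using w C(2) unfolding Complete_Partial_Order.chain_def by (force simp: less_le)
    moreover have "Complete_Partial_Order.chain (\<le>) (C - {w})"
      using C(2) by (auto simp: Complete_Partial_Order.chain_def)
    ultimately have "(\<Sum>u\<in>C - {w}. \<bar>y $ u\<bar>) \<le> chain_max y w"
      by (rule chain_sum_le_chain_max)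
    then have "chain_max y v \<le> height y w"
      using w(1) by (simp add: C(3) height_def sum.remove)
    also have "height y w \<le> c"
      using c w(1) C(1) by auto
    finally show ?thesis .
  qed (use c C in simp)
qed

text \<open>For positive \<open>t\<close> the 0 contributed by the empty chain cannot be what
  reaches \<open>t\<close>, so some height below \<open>v\<close> does.\<close>

lemma le_chain_max_iff:
  assumes "0 < t"
  shows "t \<le> chain_max y v \<longleftrightarrow> (\<exists>w<v. t \<le> height y w)"
proof
  assume t: "t \<le> chain_max y v"
  obtain C where C: "C \<subseteq> {..<v}" "chain_max y v = (\<Sum>u\<in>C. \<bar>y $ u\<bar>)"
    by (rule chain_max_attained)
  show "\<exists>w<v. t \<le> height y w"
  proof (rule ccontr)
    assume "\<not> ?thesis"
    then have less: "height y w < t" if "w < v" for w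
      using that by auto
    define c where "c = Max (insert 0 (height y ` {..<v}))"
    have "chain_max y v \<le> c"
      unfolding chain_max_le_iff c_def by (auto intro: Max_ge)
    moreover have "c < t"
      unfolding c_def using less assms by (subst Max_less_iff) auto
    ultimately show False
      using t by simp
  qed
next
  assume "\<exists>w<v. t \<le> height y w"
  then show "t \<le> chain_max y v"
    by (auto intro: order_trans[OF _ height_le_chain_max])
qed

lemma height_mono:
  fixes v w :: "'p::{finite,order}"
  assumes "w \<le> v"
  shows "height y w \<le> height y v"
  using assms height_le_chain_max[of w v y] chain_max_le_height[of y v]
  by (cases "w = v") (auto simp: less_le)

lemma chain_max_cong:
  assumes "\<And>w. w < v \<Longrightarrow> y $ w = z $ w"
  shows "chain_max y v = chain_max z v"
  unfolding chain_max_def using assms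
  by (intro arg_cong[of _ _ Max] image_cong sum.cong) auto

text \<open>For use in \<open>level_combination\<close>, where the thresholds are the heights: chain
  maxima introduce no further ones.\<close>

lemma chain_max_in:
  "chain_max y v \<in> insert 0 (range (height y))"
proof (cases "chain_max y v = 0")
  case False
  then have "0 < chain_max y v"
    using chain_max_nonneg[of y v] by simp
  then obtain w where "w < v" "chain_max y v \<le> height y w"
    using le_chain_max_iff[of "chain_max y v" y v] by auto
  then have "chain_max y v = height y w"
    using height_le_chain_max[of w v y] by simp
  then show ?thesis
    by auto
qed simp

text \<open>The recursion disappears in the inverse direction: the maximum that the transfer map
  subtracts is taken over transferred values, which are the entries of \<open>y\<close>
  itself.\<close>

definition untransfer :: "real ^ 'p::{finite,order} \<Rightarrow> real ^ 'p::{finite,order}" where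
  "untransfer y = (\<chi> v. y $ v + chain_max y v)"

text \<open>Induction along the order: \<open>chain_max y v\<close> depends only on the entries
  below \<open>v\<close>, so the entry at \<open>v\<close> can be recovered.\<close>

lemma inj_untransfer: "inj untransfer"
proof (rule injI)
  fix y z :: "real ^ 'p::{finite,order}"
  assume eq: "untransfer y = untransfer z"
  have "y $ v = z $ v" for v
  proof (induction "card {..<v}" arbitrary: v rule: less_induct)
    case less
    have "y $ w = z $ w" if "w < v" for w
      using that by (intro less psubset_card_mono) (auto dest: less_trans)
    then have "chain_max y v = chain_max z v"
      by (rule chain_max_cong)
    moreover have "untransfer y $ v = untransfer z $ v"
      by (simp add: eq)
    ultimately show ?case
      by (simp add: untransfer_def)
  qed
  then show "y = z"
    by (simp add: vec_eq_iff)
qed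

text \<open>The two maxima differ only by the empty chain. It gives 0 at a minimal element;
  elsewhere a singleton chain has a sum at least as large.\<close>

lemma untransfer_transfer: "untransfer (enriched_transfer x) = x"
proof -
  have "transfer_coord x v = x $ v - chain_max (enriched_transfer x) v" for v
  proof (cases "minimal_in UNIV v")
    case True
    then have "{..<v} = {}"
      by (auto simp: minimal_in_def)
    then show ?thesis
      using True chain_max_le_iff[of "enriched_transfer x" v 0]
        chain_max_nonneg[of "enriched_transfer x" v]
      by (auto simp: transfer_coord.simps[of x v])
  next
    case False
    let ?y = "enriched_transfer x"
    let ?S = "\<lambda>C. \<Sum>w\<in>C. \<bar>?y $ w\<bar>"
    let ?\<C> = "{C. C \<noteq> {} \<and> C \<subseteq> {..<v} \<and> Complete_Partial_Order.chain (\<le>) C}"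
    obtain u where u: "u < v"
      using False by (auto simp: minimal_in_def)
    then have ne: "{u} \<in> ?\<C>"
      by (auto simp: Complete_Partial_Order.chain_def)
    have "Max (?S ` ?\<C>) = chain_max ?y v"
    proof (rule antisym)
      show "Max (?S ` ?\<C>) \<le> chain_max ?y v"
        using ne by (intro Max.boundedI) (auto intro: chain_sum_le_chain_max)
      obtain C where C: "C \<subseteq> {..<v}" "Complete_Partial_Order.chain (\<le>) C" "chain_max ?y v = ?S C"
        by (rule chain_max_attained)
      show "chain_max ?y v \<le> Max (?S ` ?\<C>)"
      proof (cases "C = {}")
        case True
        then have "chain_max ?y v \<le> ?S {u}"
          using C by simp
        also have "\<dots> \<le> Max (?S ` ?\<C>)"
          by (intro Max_ge imageI ne) auto
        finally show ?thesis .
      qed (use C in \<open>auto intro!: Max_ge\<close>)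
    qed
    then show ?thesis
      using False by (subst transfer_coord.simps) (simp add: enriched_transfer_def)
  qed
  moreover have "enriched_transfer x $ v = transfer_coord x v" for v
    by (simp add: enriched_transfer_def)
  ultimately show ?thesis
    by (simp add: vec_eq_iff untransfer_def)
qed

lemma transfer_untransfer: "enriched_transfer (untransfer y) = y"
  by (rule injD[OF inj_untransfer]) (simp add: untransfer_transfer)

section \<open>Chains of enriched filters\<close>

text \<open>This is the transfer map on enriched filters (\<open>transfer_enriched_filter\<close>),
  in a form without recursion.\<close>

definition min_part :: "real ^ 'p::{finite,order} \<Rightarrow> real ^ 'p::{finite,order}" where
  "min_part f = (\<chi> v. if minimal_in (supp f) v then f $ v else 0)"

lemma in_enriched_filters_iff:
  "f \<in> enriched_filters \<longleftrightarrow>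
     (\<forall>v. f $ v \<in> {1, 0, -1}) \<and> order_filter (supp f) \<and>
     (\<forall>v\<in>supp f. \<not> minimal_in (supp f) v \<longrightarrow> f $ v = 1)"
proof -
  have int: "f \<in> integer_points" if "\<forall>v. f $ v \<in> {1, 0, -1}"
  proof -
    have "f $ v \<in> \<int>" for v
      using that[rule_format, of v] by auto
    then show ?thesis
      by (simp add: integer_points_def)
  qed
  have "(\<forall>v. f $ v = -1 \<longrightarrow> minimal_in (supp f) v) \<longleftrightarrow>
      (\<forall>v\<in>supp f. \<not> minimal_in (supp f) v \<longrightarrow> f $ v = 1)" (is "?L \<longleftrightarrow> ?R")
    if val: "\<forall>v. f $ v \<in> {1, 0, -1}"
  proof
    assume ?L
    with val show ?R
      by (auto simp: supp_def)
  next
    assume R: ?R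
    show ?L
    proof (intro allI impI, rule ccontr)
      fix v assume v: "f $ v = -1" "\<not> minimal_in (supp f) v"
      then have "v \<in> supp f"
        by (simp add: supp_def)
      with R v have "f $ v = 1"
        by blast
      with v(1) show False
        by simp
    qed
  qed
  with int show ?thesis
    unfolding enriched_filters_def by blast
qed

lemma enriched_filter_abs_eq_1:
  assumes "f \<in> enriched_filters" "v \<in> supp f"
  shows "\<bar>f $ v\<bar> = 1"
proof -
  have "f $ v \<in> {1, 0, -1}"
    using assms by (simp add: in_enriched_filters_iff)
  moreover have "f $ v \<noteq> 0"
    using assms by (simp add: supp_def)
  ultimately show ?thesis
    by auto
qed

lemma enriched_filter_sign:
  "f \<in> enriched_filters \<Longrightarrow> v \<in> supp f \<Longrightarrow> f $ v = 1 \<or> f $ v = -1"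
  using enriched_filter_abs_eq_1[of f v] by linarith

lemma enriched_filter_nonminimal:
  "f \<in> enriched_filters \<Longrightarrow> v \<in> supp f \<Longrightarrow> \<not> minimal_in (supp f) v \<Longrightarrow> f $ v = 1"
  by (simp add: in_enriched_filters_iff)

lemma enriched_filter_upward:
  "f \<in> enriched_filters \<Longrightarrow> w \<in> supp f \<Longrightarrow> w < v \<Longrightarrow> v \<in> supp f"
  by (auto simp: in_enriched_filters_iff order_filter_def)

lemma not_in_supp: "v \<notin> supp f \<longleftrightarrow> f $ v = 0"
  by (simp add: supp_def)

lemma finite_enriched_filters: "finite (enriched_filters :: (real ^ 'p::{finite,order}) set)"
proof (rule finite_subset)
  show "(enriched_filters :: (real ^ 'p::{finite,order}) set)
      \<subseteq> vec_lambda ` (UNIV \<rightarrow>\<^sub>E {1, 0, -1})"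
    by (rule subsetI, rule_tac x = "vec_nth x" in image_eqI)
      (auto simp: in_enriched_filters_iff PiE_def)
qed (simp add: finite_PiE)

text \<open>Non-minimal elements of the support carry the value 1. So the inequality is automatic
  there, and equal supports with equal signs at the minimal elements force
  \<open>f = g\<close>.\<close>

lemma enriched_ge_iff:
  assumes "f \<in> enriched_filters" "g \<in> enriched_filters"
  shows "enriched_ge f g \<longleftrightarrow>
    supp g \<subseteq> supp f \<and> (\<forall>v\<in>supp g. minimal_in (supp f) v \<longrightarrow> f $ v = g $ v)" (is "_ \<longleftrightarrow> ?R")
proof
  assume "enriched_ge f g"
  then show ?R
    by (auto simp: enriched_ge_def enriched_greater_def)
next
  assume R: ?R
  show "enriched_ge f g"
  proof (cases "supp f = supp g")
    case True
    have "f $ v = g $ v" for v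
    proof (cases "v \<in> supp g")
      case True
      then show ?thesis
        using R enriched_filter_nonminimal[OF assms(1), of v]
          enriched_filter_nonminimal[OF assms(2), of v] \<open>supp f = supp g\<close>
        by (cases "minimal_in (supp g) v") auto
    next
      case False
      then show ?thesis
        using \<open>supp f = supp g\<close> not_in_supp[of v f] not_in_supp[of v g] by simp
    qed
    then show ?thesis
      by (simp add: vec_eq_iff enriched_ge_def)
  next
    case False
    have "f $ v \<ge> g $ v" if "v \<in> supp g" for v
      using that R enriched_filter_nonminimal[OF assms(1), of v]
        enriched_filter_sign[OF assms(2), of v] by (cases "minimal_in (supp f) v") auto
    with False R show ?thesis
      by (auto simp: enriched_ge_def enriched_greater_def)
  qed
qed

lemma enriched_filter_chains_subset:
  "K \<in> enriched_filter_chains \<Longrightarrow> L \<subseteq> K \<Longrightarrow> L \<in> enriched_filter_chains"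
  by (auto simp: enriched_filter_chains_def Complete_Partial_Order.chain_def)

lemma enriched_filter_chains_total:
  assumes "K \<in> enriched_filter_chains" "f \<in> K" "g \<in> K"
  shows "f \<in> enriched_filters" "g \<in> enriched_filters" "enriched_ge f g \<or> enriched_ge g f"
  using assms by (auto simp: enriched_filter_chains_def Complete_Partial_Order.chain_def)

lemma enriched_filter_chains_cases:
  assumes "K \<in> enriched_filter_chains" "f \<in> K" "g \<in> K"
  shows "supp f \<subseteq> supp g \<or> supp g \<subseteq> supp f"
  using enriched_filter_chains_total[OF assms] by (auto simp: enriched_ge_def enriched_greater_def)

text \<open>This consistency of signs prevents cancellation when the minimal parts of the members of
  a chain are added.\<close>

lemma enriched_filter_chains_minimal_eq:
  assumes "K \<in> enriched_filter_chains" "f \<in> K" "g \<in> K"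
    and "minimal_in (supp f) v" "minimal_in (supp g) v"
  shows "f $ v = g $ v"
proof -
  have "v \<in> supp f" "v \<in> supp g"
    using assms(4,5) by (simp_all add: minimal_in_def)
  then show ?thesis
    using enriched_filter_chains_total[OF assms(1-3)] assms(4,5)
      enriched_ge_iff[of f g] enriched_ge_iff[of g f] by auto
qed

lemma finite_enriched_filter_chain: "K \<in> enriched_filter_chains \<Longrightarrow> finite K"
  using finite_enriched_filters by (auto simp: enriched_filter_chains_def dest: finite_subset)

lemma enriched_filter_chain_subset: "K \<in> enriched_filter_chains \<Longrightarrow> K \<subseteq> enriched_filters"
  by (simp add: enriched_filter_chains_def)

subsection \<open>Level filters\<close>

text \<open>For \<open>t > 0\<close> the first test holds exactly when some element below
  \<open>v\<close> already has height at least \<open>t\<close>, that is, when \<open>v\<close> is a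
  non-minimal element of the level set; there the value 1 is forced.\<close>

definition level_filter :: "real ^ 'p::{finite,order} \<Rightarrow> real \<Rightarrow> real ^ 'p::{finite,order}" where
  "level_filter y t =
     (\<chi> v. if t \<le> chain_max y v then 1 else if t \<le> height y v then sgn (y $ v) else 0)"

text \<open>Where the sign of \<open>y\<close> is used,
  \<open>chain_max y v < t <= height y v\<close>, so the entry of \<open>y\<close> is
  nonzero.\<close>

lemma supp_level_filter:
  assumes "0 < t"
  shows "supp (level_filter y t) = {v. t \<le> height y v}"
proof (intro set_eqI)
  fix v
  show "v \<in> supp (level_filter y t) \<longleftrightarrow> v \<in> {v. t \<le> height y v}"
    using chain_max_le_height[of y v] by (auto simp: supp_def level_filter_def sgn_if height_def)
qed

lemma minimal_level_filter:
  assumes "0 < t"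
  shows "minimal_in (supp (level_filter y t)) v \<longleftrightarrow> chain_max y v < t \<and> t \<le> height y v"
  using le_chain_max_iff[OF assms, of y v]
  by (auto simp: supp_level_filter[OF assms] minimal_in_def not_le)

lemma level_filter_in_enriched_filters:
  assumes "0 < t"
  shows "level_filter y t \<in> enriched_filters"
  unfolding in_enriched_filters_iff
proof (intro conjI allI ballI impI)
  show "level_filter y t $ v \<in> {1, 0, -1}" for v
    by (auto simp: level_filter_def sgn_if)
  show "order_filter (supp (level_filter y t))"
    unfolding order_filter_def supp_level_filter[OF assms]
    by (auto intro: order_trans[OF _ height_mono] less_imp_le)
  show "level_filter y t $ v = 1"
    if "v \<in> supp (level_filter y t)" "\<not> minimal_in (supp (level_filter y t)) v" for v
    using that minimal_level_filter[OF assms, of y v] supp_level_filter[OF assms, of y]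
    by auto (simp add: level_filter_def)
qed

lemma min_part_level_filter:
  assumes "0 < t"
  shows "min_part (level_filter y t) $ v =
    (if chain_max y v < t \<and> t \<le> height y v then sgn (y $ v) else 0)"
  by (simp add: min_part_def minimal_level_filter[OF assms]) (simp add: level_filter_def)

text \<open>An element minimal at the lower level \<open>s\<close> and still present at
  \<open>t\<close> satisfies \<open>chain_max y v < s <= t <= height y v\<close>, so both filters
  give it the sign of \<open>y\<close>.\<close>

lemma level_filters_chain: "level_filter y ` {0<..} \<in> enriched_filter_chains"
proof -
  have "enriched_ge (level_filter y s) (level_filter y t)" if "0 < s" "s \<le> t" for s t
  proof -
    have "0 < t"
      using that by simp
    have "level_filter y s $ v = level_filter y t $ v"
      if "v \<in> supp (level_filter y t)" "minimal_in (supp (level_filter y s)) v" for v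
    proof -
      have "chain_max y v < s" "t \<le> height y v"
        using that \<open>0 < s\<close> \<open>0 < t\<close> by (simp_all add: minimal_level_filter) (simp add: supp_level_filter)
      then show ?thesis
        using \<open>s \<le> t\<close> by (simp add: level_filter_def)
    qed
    moreover have "supp (level_filter y t) \<subseteq> supp (level_filter y s)"
      using that \<open>0 < t\<close> by (auto simp: supp_level_filter)
    ultimately show ?thesis
      using that \<open>0 < t\<close> by (simp add: enriched_ge_iff level_filter_in_enriched_filters)
  qed
  then have "enriched_ge (level_filter y s) (level_filter y t) \<or>
      enriched_ge (level_filter y t) (level_filter y s)" if "0 < s" "0 < t" for s t
    using that linear[of s t] by blast
  then show ?thesis
    by (auto simp: enriched_filter_chains_def Complete_Partial_Order.chain_def
        level_filter_in_enriched_filters)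
qed

subsection \<open>Recovering a chain from a convex combination\<close>

context
  fixes K :: "(real ^ 'p::{finite,order}) set" and a :: "real ^ 'p::{finite,order} \<Rightarrow> real"
    and y :: "real ^ 'p::{finite,order}"
  assumes chain: "K \<in> enriched_filter_chains"
    and a_nonneg: "\<And>f. f \<in> K \<Longrightarrow> 0 \<le> a f"
    and y_eq: "y = (\<Sum>f\<in>K. a f *\<^sub>R min_part f)"
begin

private lemma finK: "finite K"
  using chain by (rule finite_enriched_filter_chain)

private lemma K_filters: "f \<in> K \<Longrightarrow> f \<in> enriched_filters"
  using chain by (auto simp: enriched_filter_chains_def)

text \<open>The common value \<open>s\<close> is a parameter so that a \<open>v\<close> minimal in
  no support is covered too, with an arbitrary \<open>s\<close>.\<close>

private lemma y_sign:
  assumes "\<And>f. f \<in> K \<Longrightarrow> minimal_in (supp f) v \<Longrightarrow> f $ v = s"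
  shows "y $ v = s * (\<Sum>f | f \<in> K \<and> minimal_in (supp f) v. a f)"
proof -
  have "y $ v = (\<Sum>f\<in>K. if minimal_in (supp f) v then s * a f else 0)"
    unfolding y_eq sum_component using assms by (auto simp: min_part_def intro!: sum.cong)
  also have "\<dots> = s * (\<Sum>f | f \<in> K \<and> minimal_in (supp f) v. a f)"
    by (simp add: sum.inter_filter[OF finK] sum_distrib_left if_distrib[of "(*) s"] cong: if_cong)
  finally show ?thesis .
qed

private lemma abs_y: "\<bar>y $ v\<bar> = (\<Sum>f | f \<in> K \<and> minimal_in (supp f) v. a f)"
proof (cases "\<exists>g\<in>K. minimal_in (supp g) v")
  case True
  then obtain g where g: "g \<in> K" "minimal_in (supp g) v"
    by blast
  have "y $ v = g $ v * (\<Sum>f | f \<in> K \<and> minimal_in (supp f) v. a f)"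
    by (rule y_sign, rule enriched_filter_chains_minimal_eq[OF chain]) (use g in auto)
  moreover have "\<bar>g $ v\<bar> = 1"
    using g K_filters by (intro enriched_filter_abs_eq_1) (auto simp: minimal_in_def)
  ultimately show ?thesis
    using sum_nonneg[of "{f \<in> K. minimal_in (supp f) v}" a] a_nonneg by (simp add: abs_mult)
next
  case False
  then have "{f \<in> K. minimal_in (supp f) v} = {}"
    by blast
  with False show ?thesis
    using y_sign[of v 0] by (simp only: sum.empty) auto
qed

private lemma supp_split:
  "(\<Sum>f | f \<in> K \<and> v \<in> supp f. a f) =
    (\<Sum>f | f \<in> K \<and> minimal_in (supp f) v. a f) +
    (\<Sum>f | f \<in> K \<and> (\<exists>w<v. w \<in> supp f). a f)"
proof -
  have "{f \<in> K. v \<in> supp f} =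
      {f \<in> K. minimal_in (supp f) v} \<union> {f \<in> K. \<exists>w<v. w \<in> supp f}"
    using K_filters enriched_filter_upward by (auto simp: minimal_in_def)
  then show ?thesis
    using finK by (simp only:) (rule sum.union_disjoint; auto simp: minimal_in_def)
qed

text \<open>The supports are nested. Among the members whose support has an element below
  \<open>v\<close>, take one with least support: an element \<open>w < v\<close> in it lies in the
  supports of all the others, so \<open>height y w\<close> alone collects the whole sum.\<close>

lemma chain_max_combination:
  "chain_max y v = (\<Sum>f | f \<in> K \<and> (\<exists>w<v. w \<in> supp f). a f)"
proof (induction "card {..<v}" arbitrary: v rule: less_induct)
  case less
  let ?N = "\<Sum>f | f \<in> K \<and> (\<exists>w<v. w \<in> supp f). a f"
  have height: "height y w = (\<Sum>f | f \<in> K \<and> w \<in> supp f. a f)" if "w < v" for w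
  proof -
    have "card {..<w} < card {..<v}"
      using that by (intro psubset_card_mono) (auto dest: less_trans)
    then show ?thesis
      unfolding height_def supp_split abs_y using less by simp
  qed
  show ?case
  proof (rule antisym)
    show "chain_max y v \<le> ?N"
      unfolding chain_max_le_iff using a_nonneg
      by (auto simp: height finK intro!: sum_nonneg sum_mono2)
    show "?N \<le> chain_max y v"
    proof (cases "{f \<in> K. \<exists>w<v. w \<in> supp f} = {}")
      case True
      then have "?N = 0"
        by (metis sum.empty)
      then show ?thesis
        by (simp add: chain_max_nonneg)
    next
      case False
      obtain f where f: "f \<in> K" "\<exists>w<v. w \<in> supp f"
        and least: "\<And>g. g \<in> K \<Longrightarrow> \<exists>w<v. w \<in> supp g \<Longrightarrow> card (supp f) \<le> card (supp g)"
        using ex_has_least_nat[of "\<lambda>f. f \<in> K \<and> (\<exists>w<v. w \<in> supp f)" _ "\<lambda>f. card (supp f)"] False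
        by blast
      have "supp f \<subseteq> supp g" if "g \<in> K" "\<exists>w<v. w \<in> supp g" for g
        using enriched_filter_chains_cases[OF chain f(1) that(1)] least[OF that]
        by (metis card_seteq finite order_refl)
      moreover obtain w where w: "w < v" "w \<in> supp f"
        using f(2) by blast
      ultimately have "?N \<le> (\<Sum>f | f \<in> K \<and> w \<in> supp f. a f)"
        using a_nonneg by (intro sum_mono2) (auto simp: finK)
      also have "\<dots> = height y w"
        using w by (simp add: height)
      also have "\<dots> \<le> chain_max y v"
        using w(1) by (rule height_le_chain_max)
      finally show ?thesis .
    qed
  qed
qed

lemma height_combination: "height y v = (\<Sum>f | f \<in> K \<and> v \<in> supp f. a f)"
  unfolding height_def abs_y chain_max_combination supp_split ..

text \<open>At each \<open>v\<close>, the value of \<open>f\<close> is that of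
  \<open>min_part f\<close> plus the indicator that \<open>supp f\<close> has an element below
  \<open>v\<close>; by \<open>chain_max_combination\<close> the weighted indicators sum to
  \<open>chain_max y v\<close>.\<close>

lemma untransfer_combination: "untransfer y = (\<Sum>f\<in>K. a f *\<^sub>R f)"
proof -
  have "untransfer y $ v = (\<Sum>f\<in>K. a f *\<^sub>R f) $ v" for v
  proof -
    have "chain_max y v = (\<Sum>f\<in>K. if \<exists>w<v. w \<in> supp f then a f else 0)"
      by (simp add: chain_max_combination sum.inter_filter[OF finK])
    then have "untransfer y $ v =
        (\<Sum>f\<in>K. a f * min_part f $ v + (if \<exists>w<v. w \<in> supp f then a f else 0))"
      by (simp add: untransfer_def sum.distrib) (simp add: y_eq)
    also have "\<dots> = (\<Sum>f\<in>K. a f * f $ v)"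
    proof (rule sum.cong)
      fix f assume f: "f \<in> K"
      show "a f * min_part f $ v + (if \<exists>w<v. w \<in> supp f then a f else 0) = a f * f $ v"
      proof (cases "\<exists>w<v. w \<in> supp f")
        case True
        then have "v \<in> supp f"
          using K_filters[OF f] enriched_filter_upward by blast
        moreover have "\<not> minimal_in (supp f) v"
          using True by (auto simp: minimal_in_def)
        ultimately show ?thesis
          using True enriched_filter_nonminimal[OF K_filters[OF f]] by (simp add: min_part_def)
      next
        case False
        then have "minimal_in (supp f) v \<longleftrightarrow> v \<in> supp f"
          by (auto simp: minimal_in_def)
        then show ?thesis
          using False not_in_supp[of v f] by (auto simp: min_part_def)
      qed
    qed simp
    finally show ?thesis
      by simp
  qed
  then show ?thesis
    by (simp add: vec_eq_iff)
qed

lemma combination_support_levels: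
  assumes f: "f \<in> K" and pos: "0 < a f"
  shows "f \<in> level_filter y ` {0<..}"
proof
  \<comment> \<open>The level at which \<open>f\<close> is recovered is the total weight of the
    members whose support contains \<open>supp f\<close>.\<close>
  define t where "t = (\<Sum>g | g \<in> K \<and> supp f \<subseteq> supp g. a g)"
  have "a f \<le> t"
    unfolding t_def using f a_nonneg finK by (intro member_le_sum) auto
  with pos show t: "t \<in> {0<..}"
    by simp
  have level: "t \<le> height y v \<longleftrightarrow> v \<in> supp f" for v
  proof
    assume "v \<in> supp f"
    then show "t \<le> height y v"
      unfolding t_def height_combination using a_nonneg finK by (intro sum_mono2) auto
  next
    assume t: "t \<le> height y v"
    show "v \<in> supp f"
    proof (rule ccontr)
      assume v: "v \<notin> supp f"
      \<comment> \<open>Supports are nested, so every \<open>g\<close> whose support contains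
        \<open>v\<close> has a support containing \<open>supp f\<close>. Since \<open>f\<close>
        itself is lost, the height falls short of \<open>t\<close> by at least
        \<open>a f\<close>.\<close>
      have "{g \<in> K. v \<in> supp g} \<subseteq> {g \<in> K. supp f \<subseteq> supp g} - {f}"
        using v enriched_filter_chains_cases[OF chain f] by blast
      then have "height y v \<le> (\<Sum>g\<in>{g \<in> K. supp f \<subseteq> supp g} - {f}. a g)"
        unfolding height_combination using a_nonneg finK by (intro sum_mono2) auto
      also have "\<dots> = t - a f"
        unfolding t_def using f finK by (subst sum_diff1) auto
      finally show False
        using t pos by simp
    qed
  qed
  have supp: "supp (level_filter y t) = supp f"
    using t level by (auto simp: supp_level_filter)
  have "level_filter y t $ v = f $ v" if v: "minimal_in (supp f) v" for v
  proof -
    have "y $ v = f $ v * (\<Sum>g | g \<in> K \<and> minimal_in (supp g) v. a g)"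
      using enriched_filter_chains_minimal_eq[OF chain _ f _ v] by (intro y_sign) auto
    moreover have "a f \<le> (\<Sum>g | g \<in> K \<and> minimal_in (supp g) v. a g)"
      using f v a_nonneg finK by (intro member_le_sum) auto
    ultimately have "sgn (y $ v) = sgn (f $ v)"
      using pos by (simp add: sgn_mult)
    also have "\<dots> = f $ v"
      using enriched_filter_sign[OF K_filters[OF f], of v] v by (auto simp: minimal_in_def)
    finally show ?thesis
      using v minimal_level_filter[of t y v] t unfolding supp
      by (simp add: level_filter_def)
  qed
  \<comment> \<open>Equal supports rule out the strict order, so this relation is an
    equality.\<close>
  then have "enriched_ge (level_filter y t) f"
    using enriched_ge_iff[OF level_filter_in_enriched_filters K_filters[OF f], of t y] t supp
    by simp
  with supp show "f = level_filter y t"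
    by (auto simp: enriched_ge_def enriched_greater_def)
qed

end

text \<open>This is the one-element chain with coefficient 1 in
  \<open>untransfer_combination\<close>.\<close>

lemma transfer_enriched_filter:
  assumes "f \<in> enriched_filters"
  shows "enriched_transfer f = min_part f"
proof -
  have "untransfer (min_part f) = f"
    using untransfer_combination[of "{f}" "\<lambda>_. 1" "min_part f"] assms
    by (simp add: enriched_filter_chains_def Complete_Partial_Order.chain_def enriched_ge_def)
  then show ?thesis
    by (metis transfer_untransfer)
qed


section \<open>Decomposition of a point into its level filters\<close>

lemma layer_sum:
  fixes T :: "real set"
  assumes "finite T" "T \<subseteq> {0<..}" "c \<in> insert 0 T"
  shows "(\<Sum>t | t \<in> T \<and> t \<le> c. t - Max (insert 0 {s \<in> T. s < t})) = c"
  using assms(3)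
proof (induction "card {t \<in> T. t \<le> c}" arbitrary: c rule: less_induct)
  case less
  show ?case
  proof (cases "c \<in> T")
    case False
    then have "c = 0"
      using less.prems by simp
    then have "{t \<in> T. t \<le> c} = {}"
      using assms(2) by force
    then show ?thesis
      using \<open>c = 0\<close> by (simp only: sum.empty)
  next
    case True
    \<comment> \<open>\<open>c'\<close> is the threshold just before \<open>c\<close>, or 0 if there
      is none. The summand at \<open>c\<close> is \<open>c - c'\<close> and the remaining ones
      telescope to \<open>c'\<close> by induction.\<close>
    define c' where "c' = Max (insert 0 {s \<in> T. s < c})"
    have fin: "finite (insert 0 {s \<in> T. s < c})"
      using assms(1) by simp
    have "0 < c"
      using True assms(2) by auto
    have "c' \<in> insert 0 {s \<in> T. s < c}"
      unfolding c'_def using fin by (intro Max_in) auto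
    then have c': "c' \<in> insert 0 T" "c' < c"
      using \<open>0 < c\<close> by auto
    have "s \<le> c'" if "s \<in> T" "s < c" for s
      unfolding c'_def using fin that by (intro Max_ge) auto
    then have eq: "{t \<in> T. t \<le> c} = insert c {t \<in> T. t \<le> c'}"
      using c' True by (force simp: less_eq_real_def)
    have notin: "c \<notin> {t \<in> T. t \<le> c'}"
      using c' by simp
    have finT: "finite {t \<in> T. t \<le> c'}"
      using assms(1) by simp
    have "card {t \<in> T. t \<le> c'} < card {t \<in> T. t \<le> c}"
      unfolding eq card_insert_disjoint[OF finT notin] by simp
    then have "(\<Sum>t | t \<in> T \<and> t \<le> c'. t - Max (insert 0 {s \<in> T. s < t})) = c'"
      using c'(1) by (rule less.hyps)
    then show ?thesis
      unfolding eq sum.insert[OF finT notin] by (simp add: c'_def)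
  qed
qed

text \<open>Each coordinate is a layer-cake sum: the gaps up to \<open>height y v\<close> without
  those up to \<open>chain_max y v\<close> leave the absolute value of the entry, and
  \<open>sgn\<close> restores its sign.\<close>

lemma level_combination:
  fixes y :: "real ^ 'p::{finite,order}"
  assumes le_1: "\<And>v. height y v \<le> 1"
  shows "y \<in> convex hull (min_part ` level_filter y ` {0<..})" (is ?Y)
    and "untransfer y \<in> convex hull (level_filter y ` {0<..})" (is ?X)
proof -
  \<comment> \<open>The threshold 1 is added so that the weights \<open>u\<close> telescope to
    exactly 1; if it exceeds all heights, its level filter is zero. The value 0 is removed because
    levels are positive.\<close>
  define T where "T = insert 1 (range (height y)) - {0}"
  define u where "u t = t - Max (insert 0 {s \<in> T. s < t})" for t
  have finT: "finite T"
    by (simp add: T_def)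
  have posT: "T \<subseteq> {0<..}"
    using height_nonneg[of y] by (auto simp: T_def less_le)
  have layer: "(\<Sum>t\<in>T. u t * of_bool (t \<le> c)) = c" if "c \<in> insert 0 T" for c
    using layer_sum[OF finT posT that] finT
    by (simp add: u_def of_bool_def sum.inter_filter if_distrib cong: if_cong)
  have layer_height: "(\<Sum>t\<in>T. u t * of_bool (t \<le> height y v)) = height y v" for v
    by (rule layer) (auto simp: T_def)
  have layer_max: "(\<Sum>t\<in>T. u t * of_bool (t \<le> chain_max y v)) = chain_max y v" for v
    using chain_max_in[of y v] by (intro layer) (auto simp: T_def)
  have "sum u T = (\<Sum>t\<in>T. u t * of_bool (t \<le> 1))"
    using le_1 by (intro sum.cong) (auto simp: T_def)
  also have "\<dots> = 1"
    by (rule layer) (simp add: T_def)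
  finally have sum_u: "sum u T = 1" .
  have u_nonneg: "0 \<le> u t" if "t \<in> T" for t
  proof -
    have "Max (insert 0 {s \<in> T. s < t}) \<le> t"
      using finT posT that by (intro Max.boundedI) auto
    then show ?thesis
      by (simp add: u_def)
  qed
  have sgn: "sgn (y $ v) * (height y v - chain_max y v) = y $ v" for v
    by (simp add: height_def sgn_mult_abs)
  have min_part_eq: "min_part (level_filter y t) $ v =
      sgn (y $ v) * (of_bool (t \<le> height y v) - of_bool (t \<le> chain_max y v))"
    and level_eq: "level_filter y t $ v =
      sgn (y $ v) * (of_bool (t \<le> height y v) - of_bool (t \<le> chain_max y v)) +
      of_bool (t \<le> chain_max y v)" if "t \<in> T" for t v
  proof -
    have "0 < t"
      using that posT by auto
    then show "min_part (level_filter y t) $ v =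
        sgn (y $ v) * (of_bool (t \<le> height y v) - of_bool (t \<le> chain_max y v))"
      using chain_max_le_height[of y v] by (auto simp: min_part_level_filter)
    show "level_filter y t $ v =
        sgn (y $ v) * (of_bool (t \<le> height y v) - of_bool (t \<le> chain_max y v)) +
        of_bool (t \<le> chain_max y v)"
      using chain_max_le_height[of y v] by (auto simp: level_filter_def)
  qed
  have part: "(\<Sum>t\<in>T. u t * min_part (level_filter y t) $ v) = y $ v" for v
  proof -
    have "(\<Sum>t\<in>T. u t * min_part (level_filter y t) $ v) =
        (\<Sum>t\<in>T. sgn (y $ v) *
          (u t * of_bool (t \<le> height y v) - u t * of_bool (t \<le> chain_max y v)))"
      by (intro sum.cong) (simp_all add: min_part_eq algebra_simps)
    also have "\<dots> = sgn (y $ v) * (height y v - chain_max y v)"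
      by (simp only: sum_distrib_left[symmetric] sum_subtractf layer_height layer_max)
    finally show ?thesis
      by (simp add: sgn)
  qed
  have "y = (\<Sum>t\<in>T. u t *\<^sub>R min_part (level_filter y t))"
    by (simp add: vec_eq_iff part)
  also have "\<dots> \<in> convex hull (min_part ` level_filter y ` {0<..})"
    using posT finT u_nonneg sum_u by (intro convex_sum) (auto intro!: hull_inc)
  finally show ?Y .
  \<comment> \<open>The extra indicator sums to \<open>chain_max y v\<close>, which turns
    \<open>y\<close> into \<open>untransfer y\<close>.\<close>
  have "(\<Sum>t\<in>T. u t * level_filter y t $ v) = untransfer y $ v" for v
  proof -
    have "(\<Sum>t\<in>T. u t * level_filter y t $ v) =
        (\<Sum>t\<in>T. u t * min_part (level_filter y t) $ v + u t * of_bool (t \<le> chain_max y v))"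
      by (intro sum.cong) (simp_all only: min_part_eq level_eq distrib_left)
    then show ?thesis
      by (simp only: sum.distrib part layer_max untransfer_def vec_lambda_beta)
  qed
  then have "untransfer y = (\<Sum>t\<in>T. u t *\<^sub>R level_filter y t)"
    by (simp add: vec_eq_iff)
  also have "\<dots> \<in> convex hull (level_filter y ` {0<..})"
    using posT finT u_nonneg sum_u by (intro convex_sum) (auto intro!: hull_inc)
  finally show ?X .
qed

subsection \<open>Heights on the two polytopes\<close>

lemma finite_enriched_antichains: "finite (enriched_antichains :: (real ^ 'p::{finite,order}) set)"
proof (rule finite_subset)
  show "(enriched_antichains :: (real ^ 'p::{finite,order}) set)
      \<subseteq> vec_lambda ` (UNIV \<rightarrow>\<^sub>E {1, 0, -1})"
    by (rule subsetI, rule_tac x = "vec_nth x" in image_eqI)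
      (auto simp: enriched_antichains_def PiE_def)
qed (simp add: finite_PiE)

text \<open>An antichain containing \<open>v\<close> contains nothing below \<open>v\<close>. Hence
  the entry at \<open>v\<close> and the chains below \<open>v\<close> draw their weight from
  disjoint sets of antichains, and the total weight is 1.\<close>

lemma height_le_1_of_chain_polytope:
  fixes y :: "real ^ 'p::{finite,order}"
  assumes "y \<in> enriched_chain_polytope"
  shows "height y v \<le> 1"
proof -
  let ?A = "enriched_antichains :: (real ^ 'p::{finite,order}) set"
  obtain b where b: "\<And>g. g \<in> ?A \<Longrightarrow> 0 \<le> b g" "sum b ?A = 1"
    and y: "y = (\<Sum>g\<in>?A. b g *\<^sub>R g)"
    using assms unfolding enriched_chain_polytope_def
      convex_hull_finite[OF finite_enriched_antichains] by auto
  have bound: "height y v \<le> (\<Sum>g\<in>?A. b g * of_bool (\<exists>w\<le>v. w \<in> supp g))" for v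
  proof (induction "card {..<v}" arbitrary: v rule: less_induct)
    case less
    have "\<bar>y $ v\<bar> \<le> (\<Sum>g\<in>?A. \<bar>b g * g $ v\<bar>)"
      unfolding y by (simp add: sum_abs)
    also have "\<dots> \<le> (\<Sum>g\<in>?A. b g * of_bool (v \<in> supp g))"
    proof (rule sum_mono)
      fix g assume g: "g \<in> ?A"
      then have "g $ v \<in> {1, 0, -1}"
        by (simp add: enriched_antichains_def)
      then show "\<bar>b g * g $ v\<bar> \<le> b g * of_bool (v \<in> supp g)"
        using b(1)[OF g] by (auto simp: supp_def)
    qed
    finally have y_le: "\<bar>y $ v\<bar> \<le> (\<Sum>g\<in>?A. b g * of_bool (v \<in> supp g))" .
    have max_le: "chain_max y v \<le> (\<Sum>g\<in>?A. b g * of_bool (\<exists>w<v. w \<in> supp g))"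
      unfolding chain_max_le_iff
    proof (intro conjI allI impI)
      fix w assume "w < v"
      then have "card {..<w} < card {..<v}"
        by (intro psubset_card_mono) (auto dest: less_trans)
      then have "height y w \<le> (\<Sum>g\<in>?A. b g * of_bool (\<exists>u\<le>w. u \<in> supp g))"
        by (rule less)
      also have "\<dots> \<le> (\<Sum>g\<in>?A. b g * of_bool (\<exists>w<v. w \<in> supp g))"
        using \<open>w < v\<close> b(1) by (intro sum_mono mult_left_mono) (auto dest: le_less_trans)
      finally show "height y w \<le> (\<Sum>g\<in>?A. b g * of_bool (\<exists>w<v. w \<in> supp g))" .
    qed (use b(1) in \<open>auto intro: sum_nonneg\<close>)
    have "height y v \<le>
        (\<Sum>g\<in>?A. b g * of_bool (v \<in> supp g) + b g * of_bool (\<exists>w<v. w \<in> supp g))"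
      using y_le max_le by (simp add: height_def sum.distrib)
    also have "\<dots> \<le> (\<Sum>g\<in>?A. b g * of_bool (\<exists>w\<le>v. w \<in> supp g))"
    proof (rule sum_mono)
      fix g assume g: "g \<in> ?A"
      then have "\<not> (v \<in> supp g \<and> (\<exists>w<v. w \<in> supp g))"
        by (auto simp: enriched_antichains_def antichain_def)
      then show "b g * of_bool (v \<in> supp g) + b g * of_bool (\<exists>w<v. w \<in> supp g)
          \<le> b g * of_bool (\<exists>w\<le>v. w \<in> supp g)"
        using b(1)[OF g] by (auto simp: less_le)
    qed
    finally show ?case .
  qed
  also have "(\<Sum>g\<in>?A. b g * of_bool (\<exists>w\<le>v. w \<in> supp g)) \<le> sum b ?A"
    using b(1) by (intro sum_mono) auto
  finally show ?thesis
    using b(2) by simp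
qed

text \<open>Here \<open>height y v = max (x v) (2 * chain_max y v - x v)\<close> with \<open>y = \<Phi> x\<close>, so by induction every height is
  a convex function of \<open>x\<close>, and it suffices to bound it at the enriched filters.\<close>

lemma height_transfer_le_1_of_order_polytope:
  fixes x :: "real ^ 'p::{finite,order}"
  assumes "x \<in> enriched_order_polytope"
  shows "height (enriched_transfer x) v \<le> 1"
proof -
  let ?F = "enriched_filters :: (real ^ 'p::{finite,order}) set"
  let ?y = "enriched_transfer x"
  obtain b where b: "\<And>f. f \<in> ?F \<Longrightarrow> 0 \<le> b f" "sum b ?F = 1"
    and x: "x = (\<Sum>f\<in>?F. b f *\<^sub>R f)"
    using assms unfolding enriched_order_polytope_def
      convex_hull_finite[OF finite_enriched_filters] by auto
  have bound: "height ?y v \<le> (\<Sum>f\<in>?F. b f * of_bool (v \<in> supp f))" for v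
  proof (induction "card {..<v}" arbitrary: v rule: less_induct)
    case less
    let ?N = "\<Sum>f\<in>?F. b f * of_bool (\<exists>w<v. w \<in> supp f)"
    have max_le: "chain_max ?y v \<le> ?N"
      unfolding chain_max_le_iff
    proof (intro conjI allI impI)
      fix w assume "w < v"
      then have "card {..<w} < card {..<v}"
        by (intro psubset_card_mono) (auto dest: less_trans)
      then have "height ?y w \<le> (\<Sum>f\<in>?F. b f * of_bool (w \<in> supp f))"
        by (rule less)
      also have "\<dots> \<le> ?N"
        using \<open>w < v\<close> b(1) by (intro sum_mono mult_left_mono) auto
      finally show "height ?y w \<le> ?N" .
    qed (use b(1) in \<open>auto intro: sum_nonneg\<close>)
    have x_nth: "x $ v = (\<Sum>f\<in>?F. b f * f $ v)"
      unfolding x by simp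
    have x_le: "x $ v \<le> (\<Sum>f\<in>?F. b f * of_bool (v \<in> supp f))"
      unfolding x_nth
    proof (intro sum_mono mult_left_mono)
      fix f assume "f \<in> ?F"
      then show "f $ v \<le> of_bool (v \<in> supp f)"
        using enriched_filter_sign[of f v] by (auto simp: not_in_supp)
    qed (rule b(1))
    \<comment> \<open>The second branch of the maximum, compared filter by filter. If the support
      has an element below \<open>v\<close>, then \<open>f\<close> is 1 at \<open>v\<close> and both
      sides are 1; otherwise only the negated value of \<open>f\<close> remains on the left.\<close>
    have "2 * ?N - x $ v = (\<Sum>f\<in>?F. b f * (2 * of_bool (\<exists>w<v. w \<in> supp f) - f $ v))"
      unfolding x_nth by (simp add: sum_distrib_left sum_subtractf algebra_simps)
    also have "\<dots> \<le> (\<Sum>f\<in>?F. b f * of_bool (v \<in> supp f))"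
    proof (intro sum_mono mult_left_mono)
      fix f assume f: "f \<in> ?F"
      show "2 * of_bool (\<exists>w<v. w \<in> supp f) - f $ v \<le> of_bool (v \<in> supp f)"
      proof (cases "\<exists>w<v. w \<in> supp f")
        case True
        then have "v \<in> supp f" "\<not> minimal_in (supp f) v"
          using f enriched_filter_upward by (auto simp: minimal_in_def)
        then have "f $ v = 1"
          using f by (intro enriched_filter_nonminimal)
        with True \<open>v \<in> supp f\<close> show ?thesis
          by simp
      next
        case False
        then show ?thesis
          using enriched_filter_sign[OF f, of v] by (cases "v \<in> supp f") (auto simp: not_in_supp[of v f])
      qed
    qed (rule b(1))
    finally have N_le: "2 * ?N - x $ v \<le> (\<Sum>f\<in>?F. b f * of_bool (v \<in> supp f))" .
    have "untransfer ?y $ v = x $ v"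
      by (simp only: untransfer_transfer)
    then have "?y $ v = x $ v - chain_max ?y v"
      by (simp add: untransfer_def)
    then have "height ?y v = max (x $ v) (2 * chain_max ?y v - x $ v)"
      by (simp add: height_def)
    then show ?case
      using max_le x_le N_le by linarith
  qed
  also have "(\<Sum>f\<in>?F. b f * of_bool (v \<in> supp f)) \<le> sum b ?F"
    using b(1) by (intro sum_mono) auto
  finally show ?thesis
    using b(2) by simp
qed

section \<open>Volume of triangular simplices\<close>

text \<open>The library's volume formula for linear images needs a well-ordered index type; \<open>'a enumerated\<close>
  is a copy of the finite type \<open>'a\<close> with an arbitrary linear order.\<close>

typedef 'a enumerated = "UNIV :: 'a set" ..

instance enumerated :: (finite) finite
proof
  have "(UNIV :: 'a enumerated set) = range Abs_enumerated"
    by (metis Rep_enumerated_inverse surj_def)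
  then show "finite (UNIV :: 'a enumerated set)"
    by (metis finite finite_imageI)
qed

instantiation enumerated :: (finite) linorder
begin

definition enumerated_index :: "'a enumerated \<Rightarrow> nat" where
  "enumerated_index = (SOME g. inj g)"

definition "x \<le> y \<longleftrightarrow> enumerated_index x \<le> enumerated_index y" for x y :: "'a enumerated"

definition "x < y \<longleftrightarrow> enumerated_index x < enumerated_index y" for x y :: "'a enumerated"

lemma inj_enumerated_index: "inj (enumerated_index :: 'a enumerated \<Rightarrow> nat)"
proof -
  have "\<exists>g :: 'a enumerated \<Rightarrow> nat. inj g"
    using finite_imp_inj_to_nat_seg[of "UNIV :: 'a enumerated set"] by auto
  then show ?thesis
    unfolding enumerated_index_def by (rule someI_ex)
qed

instance
proof
  fix x y z :: "'a enumerated"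
  show "x < y \<longleftrightarrow> x \<le> y \<and> \<not> y \<le> x" "x \<le> x" "x \<le> y \<or> y \<le> x"
    "x \<le> y \<Longrightarrow> y \<le> z \<Longrightarrow> x \<le> z"
    by (auto simp: less_eq_enumerated_def less_enumerated_def)
  show "x \<le> y \<Longrightarrow> y \<le> x \<Longrightarrow> x = y"
    by (rule injD[OF inj_enumerated_index]) (simp add: less_eq_enumerated_def)
qed

end

instance enumerated :: (finite) wellorder
proof
  fix P :: "'a enumerated \<Rightarrow> bool" and a
  assume step: "\<And>x. (\<And>y. y < x \<Longrightarrow> P y) \<Longrightarrow> P x"
  show "P a"
    by (induction "enumerated_index a" arbitrary: a rule: less_induct)
      (rule step, simp add: less_enumerated_def)
qed

lemma card_enumerated: "CARD('a::finite enumerated) = CARD('a)"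
  by (rule bij_betw_same_card[of Rep_enumerated])
    (metis bij_betw_def inj_def Rep_enumerated_inject Rep_enumerated_inverse Abs_enumerated_inverse
      UNIV_I surj_def)

lemma prod_Basis_cart: "(\<Prod>b\<in>Basis. (v :: real ^ 'n) \<bullet> b) = (\<Prod>i\<in>UNIV. v $ i)"
proof -
  have "(Basis :: (real ^ 'n) set) = range (\<lambda>i. axis i 1)"
    by (auto simp: Basis_vec_def)
  moreover have "inj (\<lambda>i::'n. axis i (1::real))"
    by (auto simp: inj_def axis_eq_axis)
  ultimately have "(\<Prod>b\<in>Basis. v \<bullet> b) = (\<Prod>i\<in>UNIV. v \<bullet> axis i 1)"
    using prod.reindex[of "\<lambda>i::'n. axis i (1::real)" UNIV "\<lambda>b. v \<bullet> b"] by (simp only: o_def)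
  then show ?thesis
    by (simp add: inner_axis)
qed

text \<open>The pushforward of Lebesgue measure under a renaming of coordinates gives every box the
  same product of side lengths, and boxes determine the measure.\<close>

lemma measure_lborel_reindex:
  fixes h :: "'n::finite \<Rightarrow> 'm::finite" and S :: "(real ^ 'm) set"
  assumes h: "bij h" and S: "S \<in> sets borel"
  shows "measure lborel ((\<lambda>x :: real ^ 'm. \<chi> i. x $ h i) ` S) = measure lborel S"
proof -
  define r where "r x = (\<chi> i. x $ h i)" for x :: "real ^ 'm"
  define r' where "r' x = (\<chi> j. x $ inv h j)" for x :: "real ^ 'n"
  have r_r': "r (r' x) = x" for x
    using h by (simp add: r_def r'_def vec_eq_iff bij_is_inj)
  have r'_r: "r' (r x) = x" for x
    using h by (simp add: r_def r'_def vec_eq_iff bij_is_surj surj_f_inv_f)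
  have "linear r'"
    by (auto simp: r'_def linear_iff vec_eq_iff)
  then have meas: "r' \<in> borel_measurable borel"
    by (intro borel_measurable_continuous_onI linear_continuous_on linear_conv_bounded_linear[THEN iffD1])
  have "distr lborel borel r' = lborel"
  proof (rule lborel_eqI[symmetric])
    fix l u :: "real ^ 'm"
    assume le_Basis: "\<And>b. b \<in> Basis \<Longrightarrow> l \<bullet> b \<le> u \<bullet> b"
    have le: "l $ i \<le> u $ i" for i
      using le_Basis[of "axis i 1"] by (simp add: inner_axis axis_in_Basis_iff)
    have le': "\<forall>b\<in>Basis. r l \<bullet> b \<le> r u \<bullet> b"
      using le by (auto simp: Basis_vec_def inner_axis r_def)
    have "r' -` box l u = box (r l) (r u)"
    proof (intro set_eqI)
      fix x :: "real ^ 'n"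
      have "x \<in> r' -` box l u \<longleftrightarrow> (\<forall>j. l $ j < x $ inv h j \<and> x $ inv h j < u $ j)"
        by (simp add: mem_box_cart r'_def)
      also have "\<dots> \<longleftrightarrow> (\<forall>i. l $ h i < x $ i \<and> x $ i < u $ h i)"
        using h by (metis bij_inv_eq_iff)
      finally show "x \<in> r' -` box l u \<longleftrightarrow> x \<in> box (r l) (r u)"
        by (simp add: mem_box_cart r_def)
    qed
    then have "emeasure (distr lborel borel r') (box l u) = emeasure lborel (box (r l) (r u))"
      using meas by (simp add: emeasure_distr)
    also have "\<dots> = ennreal (\<Prod>b\<in>Basis. (r u - r l) \<bullet> b)"
      using le' by (simp add: emeasure_lborel_box_eq)
    also have "(\<Prod>b\<in>Basis. (r u - r l) \<bullet> b) = (\<Prod>i\<in>UNIV. (u - l) $ h i)"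
      by (simp add: prod_Basis_cart r_def)
    also have "\<dots> = (\<Prod>b\<in>Basis. (u - l) \<bullet> b)"
      unfolding prod_Basis_cart using h by (rule prod.reindex_bij_betw)
    finally show "emeasure (distr lborel borel r') (box l u) = ennreal (\<Prod>b\<in>Basis. (u - l) \<bullet> b)" .
  qed simp
  then have "measure lborel S = measure (distr lborel borel r') S"
    by simp
  also have "\<dots> = measure lborel (r' -` S)"
    using meas S by (simp add: measure_distr)
  also have "r' -` S = r ` S"
    by (auto simp: r_r' r'_r image_iff) (metis r_r')
  finally show ?thesis
    by (simp add: r_def[abs_def])
qed

text \<open>A permutation with nonzero product never increases the rank. Ranks are only permuted, so
  their sums agree, every rank is preserved and the permutation is the identity. The order is given
  by \<open>rank\<close> because it will come from a chain of filters.\<close>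

lemma det_triangular_rank:
  fixes A :: "'a::comm_ring_1 ^ 'n::finite ^ 'n" and rank :: "'n \<Rightarrow> nat"
  assumes "inj rank" and zero: "\<And>i j. rank i < rank j \<Longrightarrow> A $ i $ j = 0"
  shows "det A = (\<Prod>i\<in>UNIV. A $ i $ i)"
proof -
  have "(\<Prod>i\<in>UNIV. A $ i $ p i) = 0" if p: "p permutes UNIV" "p \<noteq> id" for p
  proof -
    have "\<exists>i. rank i < rank (p i)"
    proof (rule ccontr)
      assume "\<not> ?thesis"
      then have le: "rank (p i) \<le> rank i" for i
        by (simp add: not_less)
      have sum: "(\<Sum>i\<in>UNIV. rank (p i)) = (\<Sum>i\<in>UNIV. rank i)"
        using permutes_bij[OF p(1)] by (rule sum.reindex_bij_betw)
      have "rank (p i) = rank i" for i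
        using sum_mono_inv[OF sum le] by simp
      then have "p i = i" for i
        using assms(1) by (auto dest: injD)
      with p(2) show False
        by auto
    qed
    with zero show ?thesis
      by (auto intro!: prod_zero)
  qed
  then have "det A = (\<Sum>p\<in>{id}. of_int (sign p) * (\<Prod>i\<in>UNIV. A $ i $ p i))"
    unfolding det_def by (intro sum.mono_neutral_right) (auto simp: permutes_id)
  then show ?thesis
    by (simp add: sign_id)
qed

text \<open>The simplex is the image of the standard simplex under the matrix with columns
  \<open>f i\<close>, whose determinant is a product of entries 1 or -1.\<close>

lemma measure_triangular_simplex_wellorder:
  fixes f :: "'n::{finite,wellorder} \<Rightarrow> real ^ ('n :: _)" and rank :: "'n \<Rightarrow> nat"
  assumes "inj rank" and zero: "\<And>i j. rank i < rank j \<Longrightarrow> f i $ j = 0"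
    and diag: "\<And>i. \<bar>f i $ i\<bar> = 1"
  shows "measure lebesgue (convex hull (insert 0 (range f))) = 1 / fact CARD('n)"
proof -
  define A :: "real ^ ('n :: _) ^ ('n :: _)" where "A = (\<chi> j i. f i $ j)"
  define std where "std = convex hull (insert 0 Basis :: (real ^ ('n :: _)) set)"
  have "det A = det (transpose A)"
    by simp
  also have "\<dots> = (\<Prod>i\<in>UNIV. transpose A $ i $ i)"
    using assms by (intro det_triangular_rank) (auto simp: transpose_def A_def)
  finally have det: "\<bar>det A\<bar> = 1"
    using diag by (simp add: abs_prod transpose_def A_def)
  have compact: "compact std"
    unfolding std_def by (intro finite_imp_compact_convex_hull) auto
  have "measure lebesgue ((*v) A ` std) = \<bar>det A\<bar> * measure lebesgue std"
    using compact
    by (subst measure_lebesgue_linear_transformation) (auto dest: compact_imp_closed compact_imp_bounded)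
  also have "measure lebesgue std = 1 / fact CARD('n)"
    using compact by (subst measure_completion) (auto dest: compact_imp_closed simp: std_def content_std_simplex)
  also have "(*v) A ` std = convex hull ((*v) A ` insert 0 Basis)"
    unfolding std_def by (rule convex_hull_linear_image) auto
  also have "(*v) A ` insert 0 Basis = insert 0 (range f)"
  proof -
    have A_axis: "A *v axis i 1 = f i" for i
      by (simp add: matrix_vector_mult_basis column_def A_def vec_eq_iff)
    have "(Basis :: (real ^ ('n :: _)) set) = range (\<lambda>i. axis i 1)"
      by (auto simp: Basis_vec_def)
    then have "(*v) A ` Basis = (*v) A ` range (\<lambda>i. axis i 1)"
      by (rule arg_cong)
    then show ?thesis
      by (simp add: image_image A_axis)
  qed
  finally show ?thesis
    by (simp add: det)
qed

text \<open>Renaming the coordinates by the ordered copy of the index type preserves both volume and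
  triangularity.\<close>

lemma measure_triangular_simplex:
  fixes f :: "'n::finite \<Rightarrow> real ^ 'n" and rank :: "'n \<Rightarrow> nat"
  assumes "inj rank" and zero: "\<And>i j. rank i < rank j \<Longrightarrow> f i $ j = 0"
    and diag: "\<And>i. \<bar>f i $ i\<bar> = 1"
  shows "measure lebesgue (convex hull (insert 0 (range f))) = 1 / fact CARD('n)"
proof -
  let ?h = "Rep_enumerated :: 'n enumerated \<Rightarrow> 'n"
  let ?r = "\<lambda>x :: real ^ 'n. \<chi> i. x $ ?h i"
  have h: "bij ?h"
    by (metis bijI' Rep_enumerated_inject Abs_enumerated_inverse UNIV_I)
  have lin: "linear ?r"
    by (auto simp: linear_iff vec_eq_iff)
  let ?S = "convex hull (insert 0 (range f))"
  have compact: "compact ?S"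
    by (intro finite_imp_compact_convex_hull) auto
  then have borel: "?S \<in> sets borel"
    by (simp add: borel_compact)
  have "measure lebesgue ?S = measure lborel ?S"
    using borel by (intro measure_completion) simp
  also have "\<dots> = measure lborel (?r ` ?S)"
    using h borel by (rule measure_lborel_reindex[symmetric])
  also have "\<dots> = measure lebesgue (?r ` ?S)"
    using compact_continuous_image[OF linear_continuous_on compact, of ?r] lin
    by (intro measure_completion[symmetric]) (auto simp: linear_conv_bounded_linear borel_compact)
  also have "?r ` ?S = convex hull (?r ` insert 0 (range f))"
    using lin by (rule convex_hull_linear_image)
  also have "?r ` insert 0 (range f) = insert 0 (range (\<lambda>i. ?r (f (?h i))))"
  proof -
    have "range f = range (\<lambda>i. f (?h i))"
      using bij_is_surj[OF h] by (metis image_image)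
    then show ?thesis
      by (simp add: image_image vec_eq_iff[symmetric] zero_vec_def)
  qed
  also have "measure lebesgue (convex hull \<dots>) = 1 / fact CARD('n enumerated)"
    using assms h
    by (intro measure_triangular_simplex_wellorder[of "rank \<circ> ?h"])
      (auto intro: inj_compose bij_is_inj)
  finally show ?thesis
    by (simp add: card_enumerated)
qed

text \<open>Positive volume forces full affine dimension \<open>d\<close>, which at most
  \<open>d + 1\<close> points can only have if there are exactly \<open>d + 1\<close> of them and
  they are affinely independent.\<close>

lemma affine_independent_triangular_simplex:
  fixes f :: "'n::finite \<Rightarrow> real ^ 'n" and rank :: "'n \<Rightarrow> nat"
  assumes "inj rank" and "\<And>i j. rank i < rank j \<Longrightarrow> f i $ j = 0"
    and "\<And>i. \<bar>f i $ i\<bar> = 1"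
  shows "\<not> affine_dependent (insert 0 (range f))"
    and "card (insert 0 (range f)) = Suc CARD('n)"
proof -
  let ?V = "insert 0 (range f)"
  have "\<not> negligible (convex hull ?V)"
    using measure_triangular_simplex[OF assms] negligible_imp_measure0
    by fastforce
  then have "\<not> dim (convex hull ?V) < DIM(real ^ 'n)"
    using negligible_lowdim by blast
  then have "CARD('n) \<le> aff_dim ?V"
    using aff_dim_zero[of "convex hull ?V"] hull_inc[of 0 "convex hull ?V" affine]
      hull_inc[of 0 ?V convex] by (simp add: aff_dim_convex_hull)
  moreover have "card ?V \<le> Suc CARD('n)"
    using card_insert_le_m1[of "Suc CARD('n)" "range f" 0] card_image_le[of UNIV f] by simp
  moreover have "aff_dim ?V \<le> int (card ?V) - 1"
    by (intro aff_dim_le_card) simp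
  moreover have "0 < card ?V"
    by (simp add: card_gt_0_iff)
  ultimately show "card ?V = Suc CARD('n)"
    by linarith
  then show "\<not> affine_dependent ?V"
    unfolding affine_independent_iff_card
    using \<open>CARD('n) \<le> aff_dim ?V\<close> \<open>aff_dim ?V \<le> int (card ?V) - 1\<close> by simp
qed

section \<open>Saturated chains\<close>

text \<open>An element minimal in the largest support stays minimal in any smaller support
  containing it, so the equalities compose.\<close>

lemma enriched_ge_trans:
  assumes "f \<in> enriched_filters" "g \<in> enriched_filters" "h \<in> enriched_filters"
    and "enriched_ge f g" "enriched_ge g h"
  shows "enriched_ge f h"
proof -
  have fg: "supp g \<subseteq> supp f" "\<And>v. v \<in> supp g \<Longrightarrow> minimal_in (supp f) v \<Longrightarrow> f $ v = g $ v"
    using assms by (auto simp: enriched_ge_iff)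
  have gh: "supp h \<subseteq> supp g" "\<And>v. v \<in> supp h \<Longrightarrow> minimal_in (supp g) v \<Longrightarrow> g $ v = h $ v"
    using assms by (auto simp: enriched_ge_iff)
  have "f $ v = h $ v" if "v \<in> supp h" "minimal_in (supp f) v" for v
  proof -
    have "v \<in> supp g" "minimal_in (supp g) v"
      using that fg(1) gh(1) by (auto simp: minimal_in_def)
    then show ?thesis
      using fg(2) gh(2) that by simp
  qed
  then show ?thesis
    using assms fg(1) gh(1) by (auto simp: enriched_ge_iff)
qed

lemma enriched_filter_chains_ge_of_card:
  assumes "K \<in> enriched_filter_chains" "f \<in> K" "g \<in> K" "card (supp g) \<le> card (supp f)"
  shows "enriched_ge f g"
proof (cases "enriched_ge f g")
  case False
  then have "enriched_ge g f"
    using enriched_filter_chains_total[OF assms(1-3)] by blast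
  then have "f = g \<or> supp f \<subset> supp g"
    by (auto simp: enriched_ge_def enriched_greater_def)
  then show ?thesis
    using assms(4) psubset_card_mono[of "supp g" "supp f"] by (auto simp: enriched_ge_def)
qed

lemma enriched_filter_chains_eq_of_card:
  assumes "K \<in> enriched_filter_chains" "f \<in> K" "g \<in> K" "card (supp g) = card (supp f)"
  shows "f = g"
proof -
  have "enriched_ge f g"
    using assms by (intro enriched_filter_chains_ge_of_card) auto
  then show ?thesis
    using assms(4) psubset_card_mono[of "supp f" "supp g"]
    by (auto simp: enriched_ge_def enriched_greater_def)
qed

lemma enriched_filter_chains_insert:
  assumes "K \<in> enriched_filter_chains" "h \<in> enriched_filters"
    and "\<And>f. f \<in> K \<Longrightarrow> enriched_ge h f \<or> enriched_ge f h"
  shows "insert h K \<in> enriched_filter_chains"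
proof -
  have "enriched_ge h h"
    by (simp add: enriched_ge_def)
  moreover have "K \<subseteq> enriched_filters" "\<forall>f\<in>K. \<forall>g\<in>K. enriched_ge f g \<or> enriched_ge g f"
    using assms(1) by (simp_all add: enriched_filter_chains_def Complete_Partial_Order.chain_def)
  moreover have "\<forall>f\<in>K. enriched_ge h f \<or> enriched_ge f h" "\<forall>f\<in>K. enriched_ge f h \<or> enriched_ge h f"
    using assms(3) by blast+
  ultimately show ?thesis
    using assms(2) unfolding enriched_filter_chains_def Complete_Partial_Order.chain_def by simp
qed

text \<open>The signs of \<open>g\<close> are kept at elements that remain minimal; \<open>s\<close>
  supplies signs only at new minimal elements. Choosing \<open>s = f\<close> is what allows the
  result to stay below a given \<open>f\<close>.\<close>

definition extend_filter ::
  "real ^ 'p::{finite,order} \<Rightarrow> 'p set \<Rightarrow> real ^ 'p::{finite,order} \<Rightarrow> real ^ 'p::{finite,order}" where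
  "extend_filter g U s = (\<chi> v. if v \<notin> U then 0 else if minimal_in U v
     then (if v \<in> supp g then g $ v else s $ v) else 1)"

lemma
  fixes g s :: "real ^ 'p::{finite,order}"
  assumes g: "g \<in> enriched_filters" and U: "order_filter U" "supp g \<subseteq> U"
    and s: "\<And>v. v \<in> U \<Longrightarrow> v \<notin> supp g \<Longrightarrow> s $ v \<in> {1, -1}"
  shows supp_extend_filter: "supp (extend_filter g U s) = U"
    and extend_filter_in_enriched_filters: "extend_filter g U s \<in> enriched_filters"
    and extend_filter_ge: "enriched_ge (extend_filter g U s) g"
proof -
  have vals: "extend_filter g U s $ v \<in> {1, -1}" if "v \<in> U" for v
    using that s[of v] enriched_filter_sign[OF g, of v] by (auto simp: extend_filter_def)
  have zero: "extend_filter g U s $ v = 0" if "v \<notin> U" for v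
    using that by (simp add: extend_filter_def)
  show supp: "supp (extend_filter g U s) = U"
    using vals zero by (fastforce simp: supp_def)
  show mem: "extend_filter g U s \<in> enriched_filters"
    unfolding in_enriched_filters_iff supp
  proof (intro conjI allI ballI impI)
    show "extend_filter g U s $ v \<in> {1, 0, -1}" for v
      using vals[of v] zero[of v] by auto
    show "order_filter U"
      by (rule U(1))
    show "extend_filter g U s $ v = 1" if "v \<in> U" "\<not> minimal_in U v" for v
      using that by (simp add: extend_filter_def)
  qed
  show "enriched_ge (extend_filter g U s) g"
    unfolding enriched_ge_iff[OF mem g] supp using U(2) by (auto simp: extend_filter_def)
qed

lemma zero_in_enriched_filters: "0 \<in> enriched_filters"
  by (simp add: in_enriched_filters_iff supp_def order_filter_def)

text \<open>A maximal chain can only fail to be saturated at a gap \<open>g < f\<close> of supports; adding to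
  \<open>supp g\<close> a maximal element of \<open>supp f - supp g\<close> fills it.\<close>

lemma saturated_extension:
  fixes K :: "(real ^ 'p::{finite,order}) set"
  assumes "K \<in> enriched_filter_chains"
  obtains L where "K \<subseteq> L" "L \<in> enriched_filter_chains"
    "\<And>i. i \<le> CARD('p) \<Longrightarrow> \<exists>f\<in>L. card (supp f) = i"
proof -
  let ?C = "enriched_filter_chains :: (real ^ 'p::{finite,order}) set set"
  have "finite ?C"
    by (rule finite_subset[of _ "Pow enriched_filters"])
      (auto simp: enriched_filter_chains_def finite_enriched_filters)
  \<comment> \<open>There are finitely many chains, so \<open>K\<close> lies in a maximal one;
    maximality puts into \<open>L\<close> every filter comparable with all its members.\<close>
  then obtain L where L: "L \<in> ?C" "K \<subseteq> L" and maximal: "\<And>M. M \<in> ?C \<Longrightarrow> L \<subseteq> M \<Longrightarrow> L = M"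
    using finite_has_maximal2[of ?C K] assms by blast
  have L_filters: "f \<in> enriched_filters" if "f \<in> L" for f
    using enriched_filter_chain_subset[OF L(1)] that by blast
  have mem: "h \<in> L" if "h \<in> enriched_filters"
    "\<And>f. f \<in> L \<Longrightarrow> enriched_ge h f \<or> enriched_ge f h" for h
    using maximal[OF enriched_filter_chains_insert[OF L(1) that]] by blast
  have "enriched_ge f 0" if "f \<in> L" for f
    unfolding enriched_ge_iff[OF L_filters[OF that] zero_in_enriched_filters]
    by (simp add: supp_def)
  then have zero: "0 \<in> L"
    using zero_in_enriched_filters by (intro mem) auto
  have full: "\<exists>f\<in>L. supp f = UNIV"
  proof -
    obtain g where g: "g \<in> L" "\<And>f. f \<in> L \<Longrightarrow> card (supp f) \<le> card (supp g)"
      using ex_has_greatest_nat[of "\<lambda>f. f \<in> L" 0 "\<lambda>f. card (supp f)" "Suc CARD('p)"] zero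
      by (auto simp: card_mono less_Suc_eq_le)
    \<comment> \<open>Extending the member with largest support to full support gives a filter above
      all of \<open>L\<close>.\<close>
    let ?h = "extend_filter g UNIV (\<chi> v. 1)"
    have h: "?h \<in> enriched_filters" "enriched_ge ?h g" "supp ?h = UNIV"
      by (intro supp_extend_filter extend_filter_in_enriched_filters extend_filter_ge
          L_filters[OF g(1)]; simp add: order_filter_def)+
    have "enriched_ge ?h f" if "f \<in> L" for f
      using h(1) L_filters[OF g(1)] L_filters[OF that] h(2)
        enriched_filter_chains_ge_of_card[OF L(1) g(1) that g(2)[OF that]]
      by (rule enriched_ge_trans)
    then have "?h \<in> L"
      using h(1) by (intro mem) auto
    with h(3) show ?thesis
      by blast
  qed
  have "\<exists>f\<in>L. card (supp f) = i" if i: "i \<le> CARD('p)" for i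
  proof (rule ccontr)
    assume gap: "\<not> ?thesis"
    have "card (supp (0 :: real ^ 'p::{finite,order})) \<le> i"
      by (simp add: supp_def)
    \<comment> \<open>\<open>g\<close> and, below, \<open>f\<close> are the members of
      \<open>L\<close> closest to the missing size \<open>i\<close> from below and from
      above.\<close>
    then obtain g where g: "g \<in> L" "card (supp g) \<le> i"
      "\<And>f. f \<in> L \<Longrightarrow> card (supp f) \<le> i \<Longrightarrow> card (supp f) \<le> card (supp g)"
      using ex_has_greatest_nat[of "\<lambda>f. f \<in> L \<and> card (supp f) \<le> i" 0 "\<lambda>f. card (supp f)" "Suc i"] zero
      by (auto simp: less_Suc_eq_le)
    obtain f0 where "f0 \<in> L" "i \<le> card (supp f0)"
      using full i by force
    then obtain f where f: "f \<in> L" "i \<le> card (supp f)"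
      "\<And>k. k \<in> L \<Longrightarrow> i \<le> card (supp k) \<Longrightarrow> card (supp f) \<le> card (supp k)"
      using ex_has_least_nat[of "\<lambda>f. f \<in> L \<and> i \<le> card (supp f)" f0 "\<lambda>f. card (supp f)"] by blast
    have less: "card (supp g) < i" "i < card (supp f)"
      using gap f g by (auto simp: less_le)
    have fg: "enriched_ge f g"
      using L(1) f(1) g(1) less by (intro enriched_filter_chains_ge_of_card) auto
    note F = L_filters[OF f(1)] and G = L_filters[OF g(1)]
    have "supp g \<subset> supp f"
      using fg less by (auto simp: enriched_ge_def enriched_greater_def)
    then obtain v where v: "v \<in> supp f" "v \<notin> supp g"
      and v_max: "\<And>w. w \<in> supp f \<Longrightarrow> w \<notin> supp g \<Longrightarrow> \<not> v < w"
      using finite_has_maximal[of "supp f - supp g"] by (auto simp: less_le)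
    let ?U = "insert v (supp g)"
    \<comment> \<open>Taking the sign of \<open>f\<close> at the new element \<open>v\<close> keeps
      \<open>?h\<close> below \<open>f\<close>.\<close>
    let ?h = "extend_filter g ?U f"
    have U: "order_filter ?U"
      unfolding order_filter_def
    proof (intro allI impI)
      fix u w assume "u \<in> ?U \<and> u < w"
      then consider "u = v" "v < w" | "u \<in> supp g" "u < w"
        by blast
      then show "w \<in> ?U"
      proof cases
        case 1
        then show ?thesis
          using v_max enriched_filter_upward[OF F v(1)] by blast
      next
        case 2
        then show ?thesis
          using enriched_filter_upward[OF G] by blast
      qed
    qed
    have s: "f $ w \<in> {1, -1}" if "w \<in> ?U" "w \<notin> supp g" for w
      using that enriched_filter_sign[OF F v(1)] by auto
    have h: "?h \<in> enriched_filters" "enriched_ge ?h g" "supp ?h = ?U"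
      using extend_filter_in_enriched_filters[OF G U subset_insertI s]
        extend_filter_ge[OF G U subset_insertI s] supp_extend_filter[OF G U subset_insertI s]
      by blast+
    have "f $ w = ?h $ w" if w: "w \<in> ?U" "minimal_in (supp f) w" for w
    proof -
      have "?U \<subseteq> supp f"
        using v(1) \<open>supp g \<subset> supp f\<close> by blast
      with w have "minimal_in ?U w"
        by (auto simp: minimal_in_def)
      then have "?h $ w = (if w \<in> supp g then g $ w else f $ w)"
        using w(1) by (simp only: extend_filter_def vec_lambda_beta not_True_eq_False if_True if_False)
      then show ?thesis
        using fg w(2) by (simp add: enriched_ge_iff[OF F G])
    qed
    then have fh: "enriched_ge f ?h"
      using v(1) \<open>supp g \<subset> supp f\<close> by (auto simp: enriched_ge_iff[OF F h(1)] h(3))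
    have "?h \<in> L"
    proof (rule mem)
      show "?h \<in> enriched_filters"
        by (rule h)
      fix k assume k: "k \<in> L"
      note K = L_filters[OF k]
      show "enriched_ge ?h k \<or> enriched_ge k ?h"
      \<comment> \<open>Members of size at most \<open>i\<close> lie below \<open>g\<close>, all
        others above \<open>f\<close>; transitivity compares them with \<open>?h\<close>.\<close>
      proof (cases "card (supp k) \<le> i")
        case True
        then have "enriched_ge g k"
          using L(1) g(1) k g(3) by (intro enriched_filter_chains_ge_of_card) auto
        then show ?thesis
          using enriched_ge_trans[OF h(1) G K h(2)] by blast
      next
        case False
        then have "enriched_ge k f"
          using L(1) f(1) k f(3) by (intro enriched_filter_chains_ge_of_card) auto
        then show ?thesis
          using enriched_ge_trans[OF K F h(1) _ fh] by blast
      qed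
    qed
    moreover have "card (supp ?h) = Suc (card (supp g))"
      unfolding h(3) using v(2) by simp
    ultimately show False
      using g(3)[of ?h] less by simp
  qed
  then show ?thesis
    using that L by blast
qed

text \<open>\<open>F v\<close> is the smallest member whose support contains \<open>v\<close>, and
  \<open>rank v\<close> is the size of that support, the stage at which \<open>v\<close> joins.
  Exactly one element joins at each stage.\<close>

lemma saturated_chain_triangular:
  fixes L :: "(real ^ 'p::{finite,order}) set"
  assumes L: "L \<in> enriched_filter_chains"
    and saturated: "\<And>i. i \<le> CARD('p) \<Longrightarrow> \<exists>f\<in>L. card (supp f) = i"
  obtains F :: "'p \<Rightarrow> real ^ 'p::{finite,order}" and rank :: "'p \<Rightarrow> nat"
  where "inj rank" "\<And>v w. rank v < rank w \<Longrightarrow> w \<notin> supp (F v)"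
    "\<And>v. minimal_in (supp (F v)) v" "L = insert 0 (range F)"
proof -
  have "\<exists>f. f \<in> L \<and> v \<in> supp f \<and>
      (\<forall>g. g \<in> L \<and> v \<in> supp g \<longrightarrow> card (supp f) \<le> card (supp g))" for v
  proof -
    obtain f where f: "f \<in> L" "card (supp f) = CARD('p)"
      using saturated by blast
    then have "supp f = UNIV"
      by (simp add: card_eq_UNIV_imp_eq_UNIV)
    then show ?thesis
      using f(1) ex_has_least_nat[of "\<lambda>f. f \<in> L \<and> v \<in> supp f" f "\<lambda>f. card (supp f)"] by auto
  qed
  then obtain F where F: "\<And>v. F v \<in> L" "\<And>v. v \<in> supp (F v)"
    and least: "\<And>v g. g \<in> L \<Longrightarrow> v \<in> supp g \<Longrightarrow> card (supp (F v)) \<le> card (supp g)"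
    by metis
  define rank where "rank v = card (supp (F v))" for v
  have not_in: "w \<notin> supp f" if "f \<in> L" "card (supp f) < rank w" for f w
    using least[of f w] that by (auto simp: rank_def)
  \<comment> \<open>The member one size smaller than \<open>F v\<close> cannot contain
    \<open>v\<close> in its support, so \<open>F v\<close> adds exactly \<open>v\<close> to
    it.\<close>
  have pred: "\<exists>g\<in>L. card (supp g) < rank v \<and> supp (F v) = insert v (supp g)" for v
  proof -
    have pos: "0 < rank v"
      unfolding rank_def using F(2)[of v] by (auto simp: card_gt_0_iff)
    moreover have "rank v \<le> CARD('p)"
      by (simp add: rank_def card_mono)
    ultimately obtain g where g: "g \<in> L" "card (supp g) = rank v - 1"
      using saturated[of "rank v - 1"] by (meson diff_le_self le_trans)
    then have less: "card (supp g) < rank v"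
      using pos by simp
    have "enriched_ge (F v) g"
      using L F(1) g(1) less by (intro enriched_filter_chains_ge_of_card) (auto simp: rank_def)
    then have "insert v (supp g) \<subseteq> supp (F v)"
      using F(2) by (auto simp: enriched_ge_def enriched_greater_def)
    moreover have "card (insert v (supp g)) = card (supp (F v))"
      using not_in[OF g(1) less] g(2) pos by (simp add: rank_def)
    ultimately have "insert v (supp g) = supp (F v)"
      by (intro card_subset_eq) auto
    with g(1) less show ?thesis
      by blast
  qed
  show ?thesis
  proof (rule that)
    show "inj rank"
    proof (rule injI)
      fix v w assume eq: "rank v = rank w"
      then have Fvw: "F v = F w"
        using enriched_filter_chains_eq_of_card[OF L F(1) F(1)] by (simp add: rank_def)
      obtain g where g: "g \<in> L" "card (supp g) < rank v" "supp (F v) = insert v (supp g)"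
        using pred by blast
      have "w \<notin> supp g"
        using g(1,2) eq by (intro not_in) auto
      then show "v = w"
        using F(2)[of w] Fvw g(3) by auto
    qed
    show "w \<notin> supp (F v)" if "rank v < rank w" for v w
      using that F(1) by (intro not_in) (auto simp: rank_def)
    show "minimal_in (supp (F v)) v" for v
    proof -
      obtain g where g: "g \<in> L" "card (supp g) < rank v" "supp (F v) = insert v (supp g)"
        using pred by blast
      have "g \<in> enriched_filters"
        using enriched_filter_chain_subset[OF L] g(1) by blast
      then have "\<not> w < v" if "w \<in> supp g" for w
        using that enriched_filter_upward not_in[OF g(1,2)] by blast
      then show ?thesis
        by (auto simp: minimal_in_def g(3))
    qed
    show "L = insert 0 (range F)"
    proof
      obtain f where f: "f \<in> L" "card (supp f) = 0"
        using saturated by blast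
      then have "f = 0"
        by (simp add: supp_def vec_eq_iff)
      then show "insert 0 (range F) \<subseteq> L"
        using f(1) F(1) by auto
      show "L \<subseteq> insert 0 (range F)"
      proof
        fix f assume f: "f \<in> L"
        show "f \<in> insert 0 (range F)"
        proof (cases "supp f = {}")
          case True
          then show ?thesis
            by (auto simp: supp_def vec_eq_iff)
        next
          case False
          \<comment> \<open>\<open>v\<close> is the element of \<open>supp f\<close> that joins
            last. The support of \<open>F v\<close> then contains all of \<open>supp f\<close> and
            is no larger, so \<open>f = F v\<close>.\<close>
          then obtain v where v: "v \<in> supp f" "\<And>w. w \<in> supp f \<Longrightarrow> rank w \<le> rank v"
            using ex_has_greatest_nat[of "\<lambda>v. v \<in> supp f" _ rank "Suc (Max (range rank))"]
            by (auto simp: less_Suc_eq_le)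
          have "w \<in> supp (F v)" if "w \<in> supp f" for w
          proof -
            have "enriched_ge (F v) (F w)"
              using L F(1) v(2)[OF that]
              by (intro enriched_filter_chains_ge_of_card) (auto simp: rank_def)
            then show ?thesis
              using F(2)[of w] by (auto simp: enriched_ge_def enriched_greater_def)
          qed
          then have "card (supp f) \<le> card (supp (F v))"
            by (intro card_mono) auto
          moreover have "card (supp (F v)) \<le> card (supp f)"
            using f v(1) by (rule least)
          ultimately have "f = F v"
            using L f F(1) by (intro enriched_filter_chains_eq_of_card) auto
          then show ?thesis
            by simp
        qed
      qed
    qed
  qed
qed

section \<open>The triangulations\<close>

lemma convex_hull_finite_image:
  fixes p :: "'a \<Rightarrow> 'b::real_vector"
  assumes "finite K" "x \<in> convex hull (p ` K)"
  obtains a where "\<And>f. f \<in> K \<Longrightarrow> 0 \<le> a f" "sum a K = (1::real)" "x = (\<Sum>f\<in>K. a f *\<^sub>R p f)"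
proof -
  \<comment> \<open>\<open>p\<close> need not be injective on \<open>K\<close>: one representative
    of each image point carries its weight, the others get 0.\<close>
  obtain K' where K': "K' \<subseteq> K" "inj_on p K'" "p ` K = p ` K'"
    using subset_image_inj[of "p ` K" p K] by auto
  have finK': "finite K'"
    using K'(1) assms(1) by (rule finite_subset)
  obtain u where u: "\<And>y. y \<in> p ` K' \<Longrightarrow> 0 \<le> u y" "sum u (p ` K') = (1::real)"
    "(\<Sum>y\<in>p ` K'. u y *\<^sub>R y) = x"
    using assms(2) unfolding K'(3) convex_hull_finite[OF finite_imageI[OF finK']] by auto
  define a where "a f = (if f \<in> K' then u (p f) else 0)" for f
  show ?thesis
  proof (rule that)
    show "0 \<le> a f" if "f \<in> K" for f
      using u(1) by (simp add: a_def)
    have "sum a K = sum a K'"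
      using assms(1) K'(1) by (intro sum.mono_neutral_right) (auto simp: a_def)
    also have "\<dots> = 1"
      using u(2) by (simp add: a_def sum.reindex[OF K'(2)])
    finally show "sum a K = 1" .
    have "(\<Sum>f\<in>K. a f *\<^sub>R p f) = (\<Sum>f\<in>K'. a f *\<^sub>R p f)"
      using assms(1) K'(1) by (intro sum.mono_neutral_right) (auto simp: a_def)
    also have "\<dots> = x"
      using u(3) by (simp add: a_def sum.reindex[OF K'(2)])
    finally show "x = (\<Sum>f\<in>K. a f *\<^sub>R p f)" ..
  qed
qed

lemma convex_hull_positive_part:
  fixes p :: "'a \<Rightarrow> 'b::real_vector"
  assumes "finite K" "\<And>f. f \<in> K \<Longrightarrow> 0 \<le> a f" "sum a K = (1::real)"
  shows "(\<Sum>f\<in>K. a f *\<^sub>R p f) \<in> convex hull (p ` {f \<in> K. 0 < a f})"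
proof -
  have pos: "0 < a f \<longleftrightarrow> a f \<noteq> 0" if "f \<in> K" for f
    using assms(2)[OF that] by auto
  have "(\<Sum>f\<in>K. a f *\<^sub>R p f) = (\<Sum>f | f \<in> K \<and> 0 < a f. a f *\<^sub>R p f)"
    using assms(1) pos by (intro sum.mono_neutral_right) auto
  moreover have "sum a {f \<in> K. 0 < a f} = 1"
    unfolding assms(3)[symmetric] using assms(1) pos by (intro sum.mono_neutral_left) auto
  then have "(\<Sum>f | f \<in> K \<and> 0 < a f. a f *\<^sub>R p f) \<in> convex hull (p ` {f \<in> K. 0 < a f})"
    using assms(1) by (intro convex_sum) (auto intro: hull_inc)
  ultimately show ?thesis
    by simp
qed

text \<open>The carrier \<open>D x\<close> of a point makes the simplices fit together: two simplices through \<open>x\<close>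
  both contain \<open>x\<close> in a face spanned by a part of the affinely independent set \<open>p ` D x\<close>.\<close>

lemma unimodular_triangulation_of_chains:
  fixes p :: "real ^ 'p::{finite,order} \<Rightarrow> real ^ 'p::{finite,order}"
    and X :: "(real ^ 'p::{finite,order}) set"
  assumes p_zero: "p 0 = 0"
    and p_outside: "\<And>f v. f \<in> enriched_filters \<Longrightarrow> v \<notin> supp f \<Longrightarrow> p f $ v = 0"
    and p_minimal: "\<And>f v. f \<in> enriched_filters \<Longrightarrow> minimal_in (supp f) v \<Longrightarrow> \<bar>p f $ v\<bar> = 1"
    and p_integer: "\<And>f. f \<in> enriched_filters \<Longrightarrow> p f \<in> integer_points"
    and D: "\<And>x. D x \<in> enriched_filter_chains"
    and carrier: "\<And>K x. K \<in> enriched_filter_chains \<Longrightarrow> x \<in> convex hull (p ` K) \<Longrightarrow>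
      \<exists>L. L \<subseteq> K \<and> L \<subseteq> D x \<and> x \<in> convex hull (p ` L)"
    and X: "X = (\<Union>K\<in>enriched_filter_chains. convex hull (p ` K))" "lattice_polytope X"
  shows "unimodular_triangulation {convex hull (p ` K) |K. K \<in> enriched_filter_chains} X"
proof -
  let ?C = "enriched_filter_chains :: (real ^ 'p::{finite,order}) set set"
  let ?\<Delta> = "{convex hull (p ` K) |K. K \<in> ?C}"
  \<comment> \<open>Every chain extends to one with a full-dimensional simplex, from which
    independence, injectivity, dimension and volume are all read off.\<close>
  have big: "\<exists>L. K \<subseteq> L \<and> L \<in> ?C \<and> measure lebesgue (convex hull (p ` L)) = 1 / fact CARD('p) \<and>
      \<not> affine_dependent (p ` L) \<and> inj_on p L \<and> card (p ` L) = Suc CARD('p)"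
    if K: "K \<in> ?C" for K
  proof -
    obtain L where L: "K \<subseteq> L" "L \<in> ?C" "\<And>i. i \<le> CARD('p) \<Longrightarrow> \<exists>f\<in>L. card (supp f) = i"
      using saturated_extension[OF K] by blast
    obtain F and rank :: "'p \<Rightarrow> nat" where F: "inj rank"
      "\<And>v w. rank v < rank w \<Longrightarrow> w \<notin> supp (F v)"
      "\<And>v. minimal_in (supp (F v)) v" "L = insert 0 (range F)"
      using saturated_chain_triangular[OF L(2,3)] by metis
    have filters: "F v \<in> enriched_filters" for v
      using enriched_filter_chain_subset[OF L(2)] F(4) by auto
    have pL: "p ` L = insert 0 (range (\<lambda>v. p (F v)))"
      by (simp add: F(4) p_zero image_image)
    have zero: "rank v < rank w \<Longrightarrow> p (F v) $ w = 0" and diag: "\<bar>p (F v) $ v\<bar> = 1" for v w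
      using p_outside[OF filters F(2)] p_minimal[OF filters F(3)] by auto
    have card: "card (p ` L) = Suc CARD('p)"
      unfolding pL by (rule affine_independent_triangular_simplex(2)[OF F(1) zero diag])
    \<comment> \<open>\<open>L\<close> has at most \<open>d + 1\<close> members and its image
      exactly that many, so \<open>p\<close> is injective on \<open>L\<close>.\<close>
    have "card L \<le> Suc (card (range F))"
      unfolding F(4) by (rule card_insert_le_m1) auto
    also have "\<dots> \<le> Suc CARD('p)"
      by (simp add: card_image_le)
    finally have "card (p ` L) = card L"
      using card card_image_le[OF finite_enriched_filter_chain[OF L(2)], of p] by simp
    then have "inj_on p L"
      using finite_enriched_filter_chain[OF L(2)] by (intro eq_card_imp_inj_on)
    moreover have "\<not> affine_dependent (p ` L)"
      unfolding pL by (rule affine_independent_triangular_simplex(1)[OF F(1) zero diag])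
    moreover have "measure lebesgue (convex hull (p ` L)) = 1 / fact CARD('p)"
      unfolding pL by (rule measure_triangular_simplex[OF F(1) zero diag])
    ultimately show ?thesis
      using L card by blast
  qed
  have indep: "\<not> affine_dependent (p ` K)" and inj: "inj_on p K" if "K \<in> ?C" for K
    using big[OF that] affine_independent_subset inj_on_subset by (metis image_mono)+
  have fin: "finite K" if "K \<in> ?C" for K
    using that by (rule finite_enriched_filter_chain)
  have faces: "T face_of convex hull (p ` K) \<longleftrightarrow> (\<exists>L\<subseteq>K. T = convex hull (p ` L))"
    if "K \<in> ?C" for T K
    unfolding face_of_convex_hull_affine_independent[OF indep[OF that]]
    by (metis image_mono subset_image_iff)
  have inter: "convex hull (p ` K) \<inter> convex hull (p ` K') = convex hull (p ` (K \<inter> K'))"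
    if K: "K \<in> ?C" "K' \<in> ?C" for K K'
  proof
    show "convex hull (p ` (K \<inter> K')) \<subseteq> convex hull (p ` K) \<inter> convex hull (p ` K')"
      by (intro Int_greatest hull_mono image_mono) auto
    show "convex hull (p ` K) \<inter> convex hull (p ` K') \<subseteq> convex hull (p ` (K \<inter> K'))"
    proof
      fix x assume x: "x \<in> convex hull (p ` K) \<inter> convex hull (p ` K')"
      obtain L where L: "L \<subseteq> K" "L \<subseteq> D x" "x \<in> convex hull (p ` L)"
        using carrier[OF K(1)] x by blast
      obtain L' where L': "L' \<subseteq> K'" "L' \<subseteq> D x" "x \<in> convex hull (p ` L')"
        using carrier[OF K(2)] x by blast
      \<comment> \<open>Inside an affinely independent set, the hulls of two subsets meet in the
        hull of their intersection.\<close>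
      have "\<not> affine_dependent (p ` L \<union> p ` L')"
        by (rule affine_independent_subset[OF indep[OF D[of x]]]) (use L(2) L'(2) in auto)
      then have "x \<in> convex hull (p ` L \<inter> p ` L')"
        using L(3) L'(3) by (simp add: convex_hull_Int)
      also have "p ` L \<inter> p ` L' = p ` (L \<inter> L')"
        using inj_on_image_Int[OF inj[OF D] L(2) L'(2)] by simp
      also have "convex hull \<dots> \<subseteq> convex hull (p ` (K \<inter> K'))"
        using L(1) L'(1) by (intro hull_mono image_mono) blast
      finally show "x \<in> convex hull (p ` (K \<inter> K'))" .
    qed
  qed
  have complex: "simplicial_complex ?\<Delta>"
    unfolding simplicial_complex_def
  proof (intro conjI allI ballI impI)
    have "?C \<subseteq> Pow enriched_filters"
      by (auto simp: enriched_filter_chains_def)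
    then have "finite ?C"
      by (rule finite_subset) (simp add: finite_enriched_filters)
    then show "finite ?\<Delta>"
      by simp
    show "\<exists>n. n simplex S" if S: "S \<in> ?\<Delta>" for S
    proof -
      obtain K where K: "K \<in> ?C" "S = convex hull (p ` K)"
        using S by blast
      have "(int (card (p ` K)) - 1) simplex S"
        unfolding simplex_def using indep[OF K(1)] K(2) by (intro exI[of _ "p ` K"]) simp
      then show ?thesis ..
    qed
    show "T \<in> ?\<Delta>" if T: "S \<in> ?\<Delta> \<and> T face_of S" for T S
    proof -
      obtain K where K: "K \<in> ?C" "T face_of convex hull (p ` K)"
        using T by blast
      then obtain L where "L \<subseteq> K" "T = convex hull (p ` L)"
        using faces by blast
      then show ?thesis
        using enriched_filter_chains_subset[OF K(1)] by blast
    qed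
    show "S \<inter> S' face_of S" if S: "S \<in> ?\<Delta> \<and> S' \<in> ?\<Delta>" for S S'
    proof -
      obtain K K' where K: "K \<in> ?C" "K' \<in> ?C" "S = convex hull (p ` K)" "S' = convex hull (p ` K')"
        using S by blast
      show ?thesis
        unfolding K(3,4) inter[OF K(1,2)] faces[OF K(1)] by blast
    qed
  qed
  have lattice: "lattice_polytope S" if S: "S \<in> ?\<Delta>" for S
  proof -
    obtain K where K: "K \<in> ?C" "S = convex hull (p ` K)"
      using S by blast
    have "p ` K \<subseteq> integer_points"
      using p_integer enriched_filter_chain_subset[OF K(1)] by blast
    then show ?thesis
      unfolding lattice_polytope_def K(2) using fin[OF K(1)] by blast
  qed
  have dim: "aff_dim X = int CARD('p)"
  proof -
    \<comment> \<open>Extending the empty chain already gives a full-dimensional simplex inside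
      \<open>X\<close>.\<close>
    have "{} \<in> ?C"
      by (simp add: enriched_filter_chains_def Complete_Partial_Order.chain_def)
    then obtain L where L: "L \<in> ?C" "\<not> affine_dependent (p ` L)" "card (p ` L) = Suc CARD('p)"
      using big by blast
    have "aff_dim (convex hull (p ` L)) \<le> aff_dim X"
      using L(1) by (intro aff_dim_subset) (auto simp: X(1))
    then have "int CARD('p) \<le> aff_dim X"
      using aff_dim_affine_independent[OF L(2)] L(3) by (simp add: aff_dim_convex_hull)
    moreover have "aff_dim X \<le> int CARD('p)"
      using aff_dim_le_DIM[of X] by simp
    ultimately show ?thesis
      by simp
  qed
  have "measure lebesgue S = 1 / fact CARD('p)"
    if S: "S \<in> ?\<Delta>" "\<forall>T\<in>?\<Delta>. \<not> S \<subset> T" for S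
  proof -
    obtain K where K: "K \<in> ?C" "S = convex hull (p ` K)"
      using S(1) by blast
    obtain L where L: "K \<subseteq> L" "L \<in> ?C"
      "measure lebesgue (convex hull (p ` L)) = 1 / fact CARD('p)"
      using big[OF K(1)] by blast
    have "S \<subseteq> convex hull (p ` L)"
      unfolding K(2) using L(1) by (intro hull_mono image_mono)
    moreover have "convex hull (p ` L) \<in> ?\<Delta>"
      using L(2) by blast
    ultimately have "S = convex hull (p ` L)"
      using S(2) by blast
    with L(3) show ?thesis
      by simp
  qed
  moreover have "\<Union>?\<Delta> = X"
    unfolding X(1) by blast
  ultimately show ?thesis
    unfolding unimodular_triangulation_def lattice_triangulation_def
    using complex lattice dim X(2) by blast
qed

lemma min_part_in_enriched_antichains:
  assumes "f \<in> enriched_filters"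
  shows "min_part f \<in> enriched_antichains"
proof -
  have vals: "min_part f $ v \<in> {1, 0, -1}" for v
    using assms by (auto simp: min_part_def in_enriched_filters_iff)
  have "min_part f $ v \<in> \<int>" for v
    using vals[of v] by (elim insertE) simp_all
  moreover have "antichain (supp (min_part f))"
    by (auto simp: antichain_def supp_def min_part_def minimal_in_def split: if_splits)
  ultimately show ?thesis
    using vals by (simp add: enriched_antichains_def integer_points_def)
qed

theorem theorem1p4:
  "unimodular_triangulation
     (order_simplices :: (real ^ 'p::{finite,order}) set set) enriched_order_polytope \<and>
   unimodular_triangulation
     (chain_simplices :: (real ^ 'p::{finite,order}) set set) enriched_chain_polytope"
proof
  let ?C = "enriched_filter_chains :: (real ^ 'p::{finite,order}) set set"
  let ?O = "enriched_order_polytope :: (real ^ 'p::{finite,order}) set"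
  \<comment> \<open>For the order polytope the vertices are the filters themselves, and the carrier
    is read off from the transferred point.\<close>
  have "unimodular_triangulation {convex hull (id ` K) |K. K \<in> ?C} ?O"
  proof (rule unimodular_triangulation_of_chains[where
        D = "\<lambda>x. level_filter (enriched_transfer x) ` {0<..}"])
    show "?O = (\<Union>K\<in>?C. convex hull (id ` K))"
    proof
      show "?O \<subseteq> (\<Union>K\<in>?C. convex hull (id ` K))"
      proof
        fix x assume "x \<in> ?O"
        then have "x \<in> convex hull (level_filter (enriched_transfer x) ` {0<..})"
          using level_combination(2)[of "enriched_transfer x"]
            height_transfer_le_1_of_order_polytope[of x] by (simp add: untransfer_transfer)
        then show "x \<in> (\<Union>K\<in>?C. convex hull (id ` K))"
          using level_filters_chain by (auto simp del: image_image)
      qed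
      show "(\<Union>K\<in>?C. convex hull (id ` K)) \<subseteq> ?O"
        unfolding enriched_order_polytope_def
        by (auto intro: subsetD[OF hull_mono[OF enriched_filter_chain_subset]])
    qed
    show "lattice_polytope ?O"
      unfolding lattice_polytope_def enriched_order_polytope_def
      using finite_enriched_filters by (intro exI[of _ enriched_filters]) (auto simp: enriched_filters_def)
    show "\<exists>L. L \<subseteq> K \<and> L \<subseteq> level_filter (enriched_transfer x) ` {0<..} \<and> x \<in> convex hull (id ` L)"
      if K: "K \<in> ?C" and x: "x \<in> convex hull (id ` K)" for K x
    proof -
      have finK: "finite K"
        using K by (rule finite_enriched_filter_chain)
      obtain a where a: "\<And>f. f \<in> K \<Longrightarrow> 0 \<le> a f" "sum a K = 1" "x = (\<Sum>f\<in>K. a f *\<^sub>R id f)"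
        using convex_hull_finite_image[OF finK x] by blast
      \<comment> \<open>By \<open>untransfer_combination\<close> the same coefficients on the
        minimal parts give the transfer of \<open>x\<close>, whose level filters form the
        carrier.\<close>
      define y where "y = (\<Sum>f\<in>K. a f *\<^sub>R min_part f)"
      have "untransfer y = x"
        using untransfer_combination[OF K a(1) y_def] a(3) by simp
      then have "y = enriched_transfer x"
        by (metis transfer_untransfer)
      then have "{f \<in> K. 0 < a f} \<subseteq> level_filter (enriched_transfer x) ` {0<..}"
        using combination_support_levels[OF K a(1) y_def] by blast
      moreover have "x \<in> convex hull (id ` {f \<in> K. 0 < a f})"
        unfolding a(3) by (rule convex_hull_positive_part[OF finK a(1,2)])
      ultimately show ?thesis
        by blast
    qed
  qed (auto simp: level_filters_chain not_in_supp minimal_in_def enriched_filter_abs_eq_1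
      enriched_filters_def)
  then show "unimodular_triangulation order_simplices ?O"
    by (simp add: order_simplices_def order_simplex_def)
  let ?A = "enriched_chain_polytope :: (real ^ 'p::{finite,order}) set"
  \<comment> \<open>For the chain polytope \<open>min_part\<close> stands for the transfer map, with
    which it agrees on enriched filters.\<close>
  have "unimodular_triangulation {convex hull (min_part ` K) |K. K \<in> ?C} ?A"
  proof (rule unimodular_triangulation_of_chains[where D = "\<lambda>y. level_filter y ` {0<..}"])
    show "?A = (\<Union>K\<in>?C. convex hull (min_part ` K))"
    proof
      show "?A \<subseteq> (\<Union>K\<in>?C. convex hull (min_part ` K))"
        using level_combination(1) height_le_1_of_chain_polytope level_filters_chain by blast
      show "(\<Union>K\<in>?C. convex hull (min_part ` K)) \<subseteq> ?A"
      proof (rule UN_least)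
        fix K assume "K \<in> ?C"
        then have "min_part ` K \<subseteq> enriched_antichains"
          using enriched_filter_chain_subset min_part_in_enriched_antichains by blast
        then show "convex hull (min_part ` K) \<subseteq> ?A"
          unfolding enriched_chain_polytope_def by (rule hull_mono)
      qed
    qed
    show "lattice_polytope ?A"
      unfolding lattice_polytope_def enriched_chain_polytope_def
      using finite_enriched_antichains
      by (intro exI[of _ enriched_antichains]) (auto simp: enriched_antichains_def)
    show "\<exists>L. L \<subseteq> K \<and> L \<subseteq> level_filter y ` {0<..} \<and> y \<in> convex hull (min_part ` L)"
      if K: "K \<in> ?C" and y: "y \<in> convex hull (min_part ` K)" for K y
    proof -
      have finK: "finite K"
        using K by (rule finite_enriched_filter_chain)
      obtain a where a: "\<And>f. f \<in> K \<Longrightarrow> 0 \<le> a f" "sum a K = 1"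
        "y = (\<Sum>f\<in>K. a f *\<^sub>R min_part f)"
        using convex_hull_finite_image[OF finK y] by blast
      have "{f \<in> K. 0 < a f} \<subseteq> level_filter y ` {0<..}"
        using combination_support_levels[OF K a(1,3)] by blast
      moreover have "y \<in> convex hull (min_part ` {f \<in> K. 0 < a f})"
        unfolding a(3) by (rule convex_hull_positive_part[OF finK a(1,2)])
      ultimately show ?thesis
        by blast
    qed
    show "min_part f \<in> integer_points" if "f \<in> enriched_filters" for f :: "real ^ 'p::{finite,order}"
      using min_part_in_enriched_antichains[OF that] by (simp add: enriched_antichains_def)
    show "\<bar>min_part f $ v\<bar> = 1" if "f \<in> enriched_filters" "minimal_in (supp f) v"
      for f :: "real ^ 'p::{finite,order}" and v
      using enriched_filter_abs_eq_1[OF that(1), of v] that(2)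
      by (simp add: min_part_def minimal_in_def)
    show "min_part f $ v = 0" if "v \<notin> supp f" for f :: "real ^ 'p::{finite,order}" and v
      using that by (simp add: min_part_def minimal_in_def)
  qed (simp_all add: level_filters_chain min_part_def vec_eq_iff)
  moreover have "chain_simplex K = convex hull (min_part ` K)" if "K \<in> ?C" for K
    using transfer_enriched_filter enriched_filter_chain_subset[OF that]
    by (auto simp: chain_simplex_def intro!: arg_cong[of _ _ "(hull) convex"] image_cong)
  then have "chain_simplices = {convex hull (min_part ` K) |K. K \<in> ?C}"
    unfolding chain_simplices_def by (auto intro!: Collect_cong)
  ultimately show "unimodular_triangulation chain_simplices ?A"
    by simp
qed

end
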